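(* Let $\Lambda$ be a finite set of sites and $N\ge2$. For each unordered pair $\langle xy\rangle$ of distinct sites let $J'_{xy}\in\mathbb{R}$ and $J_{xy}\in\mathbb{R}$ with $|J'_{xy}|\le J_{xy}$. Let $\langle\cdot\rangle_{N,J'}$ be expectation in the $N$-vector model: spins $\sigma_x\in S^{N-1}\subset\mathbb{R}^N$, Boltzmann–Gibbs measure proportional to $e^{\sum_{\langle xy\rangle}J'_{xy}\sigma_x\cdot\sigma_y}\prod_x d\Omega(\sigma_x)$ with $d\Omega$ the uniform measure on $S^{N-1}$. Let $\langle\cdot\rangle_{XY,J}$ be expectation in the $XY$ model: angles $\theta_x\in[0,2\pi)$, measure proportional to $e^{\sum_{\langle xy\rangle}J_{xy}\cos(\theta_x-\theta_y)}\prod_x d\theta_x$. Then for all $x,y\in\Lambda$, $$|\langle\sigma_x\cdot\sigma_y\rangle_{N,J'}|\le\langle\cos(\theta_x-\theta_y)\rangle_{XY,J},$$ and, writing $\gamma_{xy}=\langle\cos2(\theta_x-\theta_y)\rangle_{XY,J}$, $$0\le\langle(\sigma_x\cdot\sigma_y)^2\rangle_{N,J'}\le\frac1N+\frac{(N-1)(N+2)}{N\,[2N-(N-2)\gamma_{xy}]}\gamma_{xy}\le\frac1N+\Big(1-\frac1N\Big)\gamma_{xy}.$$ *)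

theory Defs
  imports "HOL-Analysis.Analysis" "HOL-Probability.Probability"
begin

text \<open>Uniform (normalised-up-to-constant) measure on the unit sphere S^{N-1} of real^'n,
  N = CARD('n): the cone measure, i.e. the image of Lebesgue measure on the punctured
  unit ball under radial projection x \<mapsto> x/|x|.  This is a constant multiple of the
  surface measure d\<Omega>; constants cancel in normalised Gibbs expectations.\<close>
definition sphere_measure :: "(real ^ 'n) measure" where
  "sphere_measure =
     distr (restrict_space lborel (ball 0 1 - {0})) (restrict_space borel (sphere 0 1))
           (\<lambda>x. x /\<^sub>R norm x)"

definition angle_measure :: "real measure" where
  "angle_measure = restrict_space lborel {0..<2*pi}"

text \<open>Sum over unordered pairs <xy> of distinct sites, for symmetric summands:
  half the sum over ordered pairs of distinct sites.\<close>
definition pair_sum :: "'a set \<Rightarrow> ('a \<Rightarrow> 'a \<Rightarrow> real) \<Rightarrow> real" where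
  "pair_sum \<Lambda> g = (1/2) * (\<Sum>x\<in>\<Lambda>. \<Sum>y\<in>\<Lambda> - {x}. g x y)"

definition NV_expect ::
  "'a set \<Rightarrow> ('a \<Rightarrow> 'a \<Rightarrow> real) \<Rightarrow> (('a \<Rightarrow> real ^ 'n) \<Rightarrow> real) \<Rightarrow> real" where
  "NV_expect \<Lambda> K f =
     (let M = PiM \<Lambda> (\<lambda>_. sphere_measure);
          w = (\<lambda>\<sigma>. exp (pair_sum \<Lambda> (\<lambda>x y. K x y * (\<sigma> x \<bullet> \<sigma> y))))
      in (\<integral>\<sigma>. f \<sigma> * w \<sigma> \<partial>M) / (\<integral>\<sigma>. w \<sigma> \<partial>M))"

definition XY_expect ::
  "'a set \<Rightarrow> ('a \<Rightarrow> 'a \<Rightarrow> real) \<Rightarrow> (('a \<Rightarrow> real) \<Rightarrow> real) \<Rightarrow> real" where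
  "XY_expect \<Lambda> K f =
     (let M = PiM \<Lambda> (\<lambda>_. angle_measure);
          w = (\<lambda>\<theta>. exp (pair_sum \<Lambda> (\<lambda>x y. K x y * cos (\<theta> x - \<theta> y))))
      in (\<integral>\<theta>. f \<theta> * w \<theta> \<partial>M) / (\<integral>\<theta>. w \<theta> \<partial>M))"

end

(* Idea: fix two spin components i, j.  Given the radii r_u of the spins in the (i,j)-plane and the
   other components, the angles in that plane form an XY model with couplings J'_uv r_u r_v, and
   |J'_uv r_u r_v| <= J_uv.  Ginibre's inequality compares its correlations with those of the XY
   model with couplings J.  Summing over all planes gives the first bound, by r_x r_y <= (r_x^2 + r_y^2)/2.
   For the second bound the rotation by pi/4 in each plane supplies one more linear relation,
   (N+2) sum_k <(s_x^k)^2 (s_y^k)^2> = 1 + 2 <(s_x.s_y)^2>, after which it is algebra.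

   Ginibre's inequality: in the duplicated XY model, the substitution (a, b) -> (a - b, a + b) turns each
   cos +- cos into a kernel F(a) F(b), so the integrand becomes a limit of finite sums of such kernels,
   and the integral of F(a) F(b) is a square. *)
theory Submission
  imports Defs
begin

text \<open>Two measure-theoretic obstacles shape the proof. The half-angle substitution does not
  respect the box [0, 2 \<pi>)^2, so it is stated as an equality of laws on the torus, with the
  integrand written through unit complex numbers. And the radii are conditioned on without
  disintegrating the sphere measure: the planar angle of every spin is overwritten by an independent
  uniform one, which rotation invariance permits. The old spins then act as frozen parameters and
  the new angles carry an XY weight.

  Origin of the second bound: put P = sum_k <(s_x^k)^2 (s_y^k)^2> and V = <(s_x.s_y)^2>. Here the
  squared radii multiply to a polynomial that is summed exactly, without the mean inequality, and
  the sum over planes reads 2 (N P - 1) \<le> \<gamma> ((N - 2) P + 1). Eliminating P by the linear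
  relation leaves V (2N - (N - 2) \<gamma>) \<le> 2 + N \<gamma>.\<close>

section \<open>Product measures as images\<close>

text \<open>On a box the indicator factorises over the sites, so Tonelli reduces the claim to the
  one-site identity. The source is a pair of products, not a product of pairs, because later
  arguments integrate over one family with the other frozen. It is used for the torus substitution
  and for resampling planar angles.\<close>

lemma PiM_distr_pair:
  assumes I: "finite I" and fin1: "sigma_finite_measure M1" and fin2: "sigma_finite_measure M2"
    and finN: "sigma_finite_measure N"
    and T [measurable]: "T \<in> M1 \<Otimes>\<^sub>M M2 \<rightarrow>\<^sub>M N"
    and N: "distr (M1 \<Otimes>\<^sub>M M2) N T = N"
  shows "distr (PiM I (\<lambda>_. M1) \<Otimes>\<^sub>M PiM I (\<lambda>_. M2)) (PiM I (\<lambda>_. N))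
           (\<lambda>p. \<lambda>i\<in>I. T (fst p i, snd p i)) = PiM I (\<lambda>_. N)"
proof -
  interpret P1: product_sigma_finite "\<lambda>_. M1" using fin1 by (simp add: product_sigma_finite_def)
  interpret P2: product_sigma_finite "\<lambda>_. M2" using fin2 by (simp add: product_sigma_finite_def)
  interpret PN: product_sigma_finite "\<lambda>_. N" using finN by (simp add: product_sigma_finite_def)
  interpret S2: sigma_finite_measure "PiM I (\<lambda>_. M2)" by (rule P2.sigma_finite[OF I])
  show ?thesis
  proof (rule PN.PiM_eqI[OF I])
    fix A assume A: "\<And>i. i \<in> I \<Longrightarrow> A i \<in> sets N"
    let ?P1 = "PiM I (\<lambda>_. M1)" and ?P2 = "PiM I (\<lambda>_. M2)"
    let ?F = "\<lambda>p. \<lambda>i\<in>I. T (fst p i, snd p i)"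
    have [measurable]: "?F \<in> ?P1 \<Otimes>\<^sub>M ?P2 \<rightarrow>\<^sub>M PiM I (\<lambda>_. N)"
      by measurable
    have box: "Pi\<^sub>E I A \<in> sets (PiM I (\<lambda>_. N))" using A I by (auto intro: sets_PiM_I_finite)
    have ms [measurable]: "(\<lambda>z. indicator (A i) (T z) :: ennreal) \<in> borel_measurable (M1 \<Otimes>\<^sub>M M2)" if "i \<in> I" for i
      using measurable_compose[OF T borel_measurable_indicator[OF A[OF that]]] by simp
    have "emeasure (distr (?P1 \<Otimes>\<^sub>M ?P2) (PiM I (\<lambda>_. N)) ?F) (Pi\<^sub>E I A)
        = (\<integral>\<^sup>+ p. indicator (Pi\<^sub>E I A) (?F p) \<partial>(?P1 \<Otimes>\<^sub>M ?P2))"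
    proof -
      have "emeasure (distr (?P1 \<Otimes>\<^sub>M ?P2) (PiM I (\<lambda>_. N)) ?F) (Pi\<^sub>E I A)
          = (\<integral>\<^sup>+ y. indicator (Pi\<^sub>E I A) y \<partial>distr (?P1 \<Otimes>\<^sub>M ?P2) (PiM I (\<lambda>_. N)) ?F)"
        using box by (simp add: nn_integral_indicator del: PiE_iff)
      also have "\<dots> = (\<integral>\<^sup>+ p. indicator (Pi\<^sub>E I A) (?F p) \<partial>(?P1 \<Otimes>\<^sub>M ?P2))"
        by (rule nn_integral_distr) (use box in auto)
      finally show ?thesis .
    qed
    also have "\<dots> = (\<integral>\<^sup>+ p. (\<Prod>i\<in>I. indicator (A i) (T (fst p i, snd p i))) \<partial>(?P1 \<Otimes>\<^sub>M ?P2))"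
    proof (intro nn_integral_cong)
      fix p show "indicator (Pi\<^sub>E I A) (?F p) = (\<Prod>i\<in>I. indicator (A i) (T (fst p i, snd p i)) :: ennreal)"
      proof (cases "\<forall>i\<in>I. T (fst p i, snd p i) \<in> A i")
        case True
        then have "?F p \<in> Pi\<^sub>E I A" by auto
        with True show ?thesis by simp
      next
        case False
        then have "?F p \<notin> Pi\<^sub>E I A" by (auto simp: PiE_iff)
        moreover have "(\<Prod>i\<in>I. indicator (A i) (T (fst p i, snd p i)) :: ennreal) = 0"
          using False I by (intro prod_zero) (auto simp: indicator_def)
        ultimately show ?thesis by simp
      qed
    qed
    also have "\<dots> = (\<integral>\<^sup>+ a. \<integral>\<^sup>+ b. (\<Prod>i\<in>I. indicator (A i) (T (a i, b i))) \<partial>?P2 \<partial>?P1)"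
      using S2.nn_integral_fst[of "\<lambda>p. \<Prod>i\<in>I. indicator (A i) (T (fst p i, snd p i))" ?P1]
      by simp
    also have "\<dots> = (\<integral>\<^sup>+ a. (\<Prod>i\<in>I. \<integral>\<^sup>+ b. indicator (A i) (T (a i, b)) \<partial>M2) \<partial>?P1)"
    proof (intro nn_integral_cong)
      fix a assume a: "a \<in> space ?P1"
      then have "\<And>i. i \<in> I \<Longrightarrow> a i \<in> space M1" by (auto simp: space_PiM)
      then show "(\<integral>\<^sup>+ b. (\<Prod>i\<in>I. indicator (A i) (T (a i, b i))) \<partial>?P2)
          = (\<Prod>i\<in>I. \<integral>\<^sup>+ b. indicator (A i) (T (a i, b)) \<partial>M2)"
        by (intro P2.product_nn_integral_prod[OF I, where f="\<lambda>i b. indicator (A i) (T (a i, b))"])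
           measurable
    qed
    also have "\<dots> = (\<Prod>i\<in>I. \<integral>\<^sup>+ a. \<integral>\<^sup>+ b. indicator (A i) (T (a, b)) \<partial>M2 \<partial>M1)"
      by (intro P1.product_nn_integral_prod[OF I, where f="\<lambda>i a. \<integral>\<^sup>+ b. indicator (A i) (T (a, b)) \<partial>M2"])
         measurable
    also have "\<dots> = (\<Prod>i\<in>I. emeasure N (A i))"
    proof (intro prod.cong refl)
      fix i assume i: "i \<in> I"
      have "emeasure N (A i) = (\<integral>\<^sup>+ y. indicator (A i) y \<partial>distr (M1 \<Otimes>\<^sub>M M2) N T)"
        using A[OF i] by (simp add: N)
      also have "\<dots> = (\<integral>\<^sup>+ p. indicator (A i) (T p) \<partial>(M1 \<Otimes>\<^sub>M M2))"
        using A[OF i] by (intro nn_integral_distr) auto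
      also have "\<dots> = (\<integral>\<^sup>+ a. \<integral>\<^sup>+ b. indicator (A i) (T (a, b)) \<partial>M2 \<partial>M1)"
        by (rule sigma_finite_measure.nn_integral_fst[OF fin2 ms[OF i], symmetric])
      finally show "(\<integral>\<^sup>+ a. \<integral>\<^sup>+ b. indicator (A i) (T (a, b)) \<partial>M2 \<partial>M1) = emeasure N (A i)" ..
    qed
    finally show "emeasure (distr (?P1 \<Otimes>\<^sub>M ?P2) (PiM I (\<lambda>_. N)) ?F) (Pi\<^sub>E I A) = (\<Prod>i\<in>I. emeasure N (A i))" .
  qed simp
qed

section \<open>Uniform measure on the circle\<close>

lemma emeasure_angle_measure: "emeasure angle_measure (space angle_measure) = ennreal (2*pi)"
  by (simp add: angle_measure_def space_restrict_space emeasure_restrict_space)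

lemma finite_measure_angle: "finite_measure angle_measure"
  by (rule finite_measureI) (simp add: emeasure_angle_measure)

lemma borel_measurable_angle: "(\<lambda>x. x) \<in> angle_measure \<rightarrow>\<^sub>M borel"
  unfolding angle_measure_def by (auto intro: measurable_restrict_space1)

lemma measurable_angle_borelD [measurable (raw)]:
  "f \<in> M \<rightarrow>\<^sub>M angle_measure \<Longrightarrow> f \<in> M \<rightarrow>\<^sub>M borel"
  using measurable_compose[OF _ borel_measurable_angle] by auto

lemma nn_integral_angle_measure:
  "integral\<^sup>N angle_measure f = (\<integral>\<^sup>+ t. f t * indicator {0..<2*pi} t \<partial>lborel)"
  unfolding angle_measure_def by (subst nn_integral_restrict_space) auto

lemma periodic_of_int:
  fixes f :: "real \<Rightarrow> 'b"
  assumes "\<And>t. f (t + p) = f t"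
  shows "f (t + of_int k * p) = f t"
proof -
  have nat: "f (t + of_nat n * p) = f t" for n t
  proof (induction n)
    case (Suc n)
    have "f (t + of_nat (Suc n) * p) = f ((t + of_nat n * p) + p)" by (simp add: algebra_simps)
    then show ?case using Suc assms by simp
  qed simp
  show ?thesis
  proof (cases "0 \<le> k")
    case True then show ?thesis using nat[of t "nat k"] by simp
  next
    case False
    then show ?thesis using nat[of "t + of_int k * p" "nat (- k)"] by (simp add: algebra_simps)
  qed
qed

text \<open>Only s modulo 2 \<pi> matters; the shifted window [r, 2 \<pi> + r) is cut at 2 \<pi> and
  its upper piece moved back by one period.\<close>

lemma nn_integral_angle_shift:
  fixes f :: "real \<Rightarrow> ennreal"
  assumes [measurable]: "f \<in> borel_measurable borel" and per: "\<And>t. f (t + 2*pi) = f t"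
  shows "(\<integral>\<^sup>+ t. f (t + s) \<partial>angle_measure) = integral\<^sup>N angle_measure f"
proof -
  define k where "k = \<lfloor>s / (2*pi)\<rfloor>"
  define r where "r = s - of_int k * (2*pi)"
  have r: "0 \<le> r" "r < 2*pi"
    using floor_divide_lower[of "2*pi" s] floor_divide_upper[of "2*pi" s]
    unfolding r_def k_def by (simp_all add: algebra_simps)
  have "f (t + s) = f (t + r)" for t
    using periodic_of_int[of f "2*pi" "t + r" k, OF per] by (simp add: r_def algebra_simps)
  then have "(\<integral>\<^sup>+ t. f (t + s) \<partial>angle_measure) = (\<integral>\<^sup>+ t. f (t + r) * indicator {0..<2*pi} t \<partial>lborel)"
    by (simp add: nn_integral_angle_measure)
  also have "\<dots> = (\<integral>\<^sup>+ t. f t * indicator {r..<2*pi+r} t \<partial>lborel)"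
    by (subst (2) nn_integral_real_affine[where c=1 and t=r])
       (auto intro!: nn_integral_cong simp: indicator_def add.commute)
  also have "\<dots> = (\<integral>\<^sup>+ t. f t * indicator {r..<2*pi} t + f t * indicator {2*pi..<2*pi+r} t \<partial>lborel)"
    using r by (intro nn_integral_cong) (auto simp: indicator_def)
  also have "\<dots> = (\<integral>\<^sup>+ t. f t * indicator {r..<2*pi} t \<partial>lborel) + (\<integral>\<^sup>+ t. f t * indicator {2*pi..<2*pi+r} t \<partial>lborel)"
    by (rule nn_integral_add) auto
  also have "(\<integral>\<^sup>+ t. f t * indicator {2*pi..<2*pi+r} t \<partial>lborel) = (\<integral>\<^sup>+ t. f t * indicator {0..<r} t \<partial>lborel)"
    by (subst nn_integral_real_affine[where c=1 and t="2*pi"])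
       (auto intro!: nn_integral_cong simp: indicator_def add.commute per)
  also have "(\<integral>\<^sup>+ t. f t * indicator {r..<2*pi} t \<partial>lborel) + \<dots>
      = (\<integral>\<^sup>+ t. f t * indicator {r..<2*pi} t + f t * indicator {0..<r} t \<partial>lborel)"
    by (rule nn_integral_add[symmetric]) auto
  also have "\<dots> = integral\<^sup>N angle_measure f"
    unfolding nn_integral_angle_measure
    using r by (intro nn_integral_cong) (auto simp: indicator_def)
  finally show ?thesis .
qed

text \<open>The doubled angle runs through two full periods at half density. The factor 2 is
  cancelled by multiplication, since the integrals may be infinite.\<close>

lemma nn_integral_angle_double:
  fixes f :: "real \<Rightarrow> ennreal"
  assumes [measurable]: "f \<in> borel_measurable borel" and per: "\<And>t. f (t + 2*pi) = f t"
  shows "(\<integral>\<^sup>+ t. f (2 * t) \<partial>angle_measure) = integral\<^sup>N angle_measure f"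
proof -
  let ?I = "\<integral>\<^sup>+ t. f t * indicator {0..<2*pi} t \<partial>lborel"
  let ?D = "\<integral>\<^sup>+ t. f (2 * t) \<partial>angle_measure"
  have 1: "?D = (\<integral>\<^sup>+ t. f (2 * t) * indicator {0..<4*pi} (2 * t) \<partial>lborel)"
    unfolding nn_integral_angle_measure by (intro nn_integral_cong) (auto simp: indicator_def)
  have 2: "(\<integral>\<^sup>+ t. f t * indicator {0..<4*pi} t \<partial>lborel) = ennreal 2 * ?D"
    unfolding 1 using nn_integral_real_affine[of "\<lambda>t. f t * indicator {0..<4*pi} t" 2 0] by simp
  have 3: "(\<integral>\<^sup>+ t. f t * indicator {2*pi..<4*pi} t \<partial>lborel) = ?I"
    by (subst nn_integral_real_affine[where c=1 and t="2*pi"])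
       (auto intro!: nn_integral_cong simp: indicator_def add.commute per)
  have "(\<integral>\<^sup>+ t. f t * indicator {0..<4*pi} t \<partial>lborel)
      = (\<integral>\<^sup>+ t. f t * indicator {0..<2*pi} t + f t * indicator {2*pi..<4*pi} t \<partial>lborel)"
    by (intro nn_integral_cong) (auto simp: indicator_def)
  also have "\<dots> = ?I + (\<integral>\<^sup>+ t. f t * indicator {2*pi..<4*pi} t \<partial>lborel)"
    by (rule nn_integral_add) auto
  finally have "ennreal 2 * ?D = ?I + ?I" unfolding 2 3 .
  then have "2 * ?D = 2 * ?I" by (simp only: mult_2[of ?I] ennreal_numeral)
  then have "?D = ?I" using ennreal_mult_cancel_left[of 2 ?D ?I] by auto
  then show ?thesis unfolding nn_integral_angle_measure[of f] .
qed

text \<open>The substitution behind the half-angle factorisation: \<open>(z, w) \<mapsto> (z w\<inverse>, z w)\<close> preserves the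
  Haar measure of the torus, although it is two-to-one.\<close>
lemma nn_integral_angle_rotate:
  fixes h :: "complex \<times> complex \<Rightarrow> ennreal"
  assumes [measurable]: "h \<in> borel_measurable (borel \<Otimes>\<^sub>M borel)"
  shows "(\<integral>\<^sup>+ p. h (cis (fst p - snd p), cis (fst p + snd p)) \<partial>(angle_measure \<Otimes>\<^sub>M angle_measure))
       = (\<integral>\<^sup>+ p. h (cis (fst p), cis (snd p)) \<partial>(angle_measure \<Otimes>\<^sub>M angle_measure))"
proof -
  interpret A: finite_measure angle_measure by (rule finite_measure_angle)
  interpret AA: pair_sigma_finite angle_measure angle_measure ..
  note [measurable] = borel_measurable_angle
  have [measurable]: "cis \<in> borel_measurable borel"
    by (intro borel_measurable_continuous_onI continuous_intros)
  have per: "cis (u + 2*pi) = cis u" for u by (simp add: complex_eq_iff)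
  have per': "cis (u + 2*pi + v) = cis (u + v)" for u v
    using per[of "u + v"] by (simp add: add_ac)
  have per'': "cis (v + (u + 2*pi)) = cis (v + u)" for u v
    using per[of "v + u"] by (simp only: add.assoc)
  have "(\<integral>\<^sup>+ p. h (cis (fst p - snd p), cis (fst p + snd p)) \<partial>(angle_measure \<Otimes>\<^sub>M angle_measure))
     = (\<integral>\<^sup>+ b. \<integral>\<^sup>+ a. h (cis (a - b), cis (a + b)) \<partial>angle_measure \<partial>angle_measure)"
    by (subst AA.nn_integral_snd[symmetric]) auto
  \<comment> \<open>At fixed \<open>b\<close>, shifting \<open>a\<close> by \<open>b\<close> turns
    the pair (a - b, a + b) into (a, 2b + a). After exchanging the integrals only a doubling and a
    shift of \<open>b\<close> remain.\<close>
  also have "\<dots> = (\<integral>\<^sup>+ b. \<integral>\<^sup>+ a. h (cis a, cis (2 * b + a)) \<partial>angle_measure \<partial>angle_measure)"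
  proof (rule nn_integral_cong)
    fix b
    show "(\<integral>\<^sup>+ a. h (cis (a - b), cis (a + b)) \<partial>angle_measure) = (\<integral>\<^sup>+ a. h (cis a, cis (2 * b + a)) \<partial>angle_measure)"
      using nn_integral_angle_shift[of "\<lambda>a. h (cis a, cis (2 * b + a))" "-b"]
      by (simp add: per per'' add.commute)
  qed
  also have "\<dots> = (\<integral>\<^sup>+ a. \<integral>\<^sup>+ b. h (cis a, cis (2 * b + a)) \<partial>angle_measure \<partial>angle_measure)"
    by (subst AA.Fubini') auto
  also have "\<dots> = (\<integral>\<^sup>+ a. \<integral>\<^sup>+ b. h (cis a, cis b) \<partial>angle_measure \<partial>angle_measure)"
  proof (rule nn_integral_cong)
    fix a
    have "(\<integral>\<^sup>+ b. h (cis a, cis (2 * b + a)) \<partial>angle_measure) = (\<integral>\<^sup>+ b. h (cis a, cis (b + a)) \<partial>angle_measure)"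
      using nn_integral_angle_double[of "\<lambda>b. h (cis a, cis (b + a))"] by (simp add: per')
    also have "\<dots> = (\<integral>\<^sup>+ b. h (cis a, cis b) \<partial>angle_measure)"
      using nn_integral_angle_shift[of "\<lambda>b. h (cis a, cis b)" a] by (simp add: per)
    finally show "(\<integral>\<^sup>+ b. h (cis a, cis (2 * b + a)) \<partial>angle_measure) = (\<integral>\<^sup>+ b. h (cis a, cis b) \<partial>angle_measure)" .
  qed
  also have "\<dots> = (\<integral>\<^sup>+ p. h (cis (fst p), cis (snd p)) \<partial>(angle_measure \<Otimes>\<^sub>M angle_measure))"
    by (subst A.nn_integral_fst[symmetric]) auto
  finally show ?thesis .
qed

text \<open>Differences and sums of angles leave [0, 2 \<pi>), so only the laws of their images
  under \<open>cis\<close> can be compared; this is why \<open>g\<close> takes complex arguments.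
  Both one-site maps have the same law \<open>N\<close>, and \<open>PiM_distr_pair\<close> carries
  this to all sites.\<close>

lemma integral_angle_rotate_PiM:
  fixes g :: "('a \<Rightarrow> complex \<times> complex) \<Rightarrow> real"
  assumes \<Lambda>: "finite \<Lambda>" and g [measurable]: "g \<in> borel_measurable (PiM \<Lambda> (\<lambda>_. borel \<Otimes>\<^sub>M borel))"
  shows "(\<integral>p. g (\<lambda>i\<in>\<Lambda>. (cis (fst p i - snd p i), cis (fst p i + snd p i)))
            \<partial>(PiM \<Lambda> (\<lambda>_. angle_measure) \<Otimes>\<^sub>M PiM \<Lambda> (\<lambda>_. angle_measure)))
       = (\<integral>p. g (\<lambda>i\<in>\<Lambda>. (cis (fst p i), cis (snd p i)))
            \<partial>(PiM \<Lambda> (\<lambda>_. angle_measure) \<Otimes>\<^sub>M PiM \<Lambda> (\<lambda>_. angle_measure)))"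
proof -
  let ?A = "angle_measure" and ?B = "borel \<Otimes>\<^sub>M borel :: (complex \<times> complex) measure"
  let ?T1 = "\<lambda>p. (cis (fst p - snd p), cis (fst p + snd p))" and ?T2 = "\<lambda>p. (cis (fst p), cis (snd p))"
  note [measurable] = borel_measurable_angle
  have [measurable]: "cis \<in> borel_measurable borel"
    by (intro borel_measurable_continuous_onI continuous_intros)
  interpret A: finite_measure ?A by (rule finite_measure_angle)
  interpret AA: finite_measure "?A \<Otimes>\<^sub>M ?A" by (intro finite_measure_pair_measure finite_measure_angle)
  define N where "N = distr (?A \<Otimes>\<^sub>M ?A) ?B ?T2"
  have T1 [measurable]: "?T1 \<in> ?A \<Otimes>\<^sub>M ?A \<rightarrow>\<^sub>M ?B" by measurable
  have T2 [measurable]: "?T2 \<in> ?A \<Otimes>\<^sub>M ?A \<rightarrow>\<^sub>M ?B" by measurable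
  have sets_N: "sets N = sets ?B" by (simp add: N_def)
  have N1: "distr (?A \<Otimes>\<^sub>M ?A) ?B ?T1 = N"
  proof (rule measure_eqI)
    fix X assume "X \<in> sets (distr (?A \<Otimes>\<^sub>M ?A) ?B ?T1)"
    then have X [measurable]: "X \<in> sets ?B" by simp
    have e: "emeasure (distr (?A \<Otimes>\<^sub>M ?A) ?B T) X = (\<integral>\<^sup>+ p. indicator X (T p) \<partial>(?A \<Otimes>\<^sub>M ?A))"
      if T: "T \<in> ?A \<Otimes>\<^sub>M ?A \<rightarrow>\<^sub>M ?B" for T
    proof -
      have "emeasure (distr (?A \<Otimes>\<^sub>M ?A) ?B T) X = (\<integral>\<^sup>+ y. indicator X y \<partial>distr (?A \<Otimes>\<^sub>M ?A) ?B T)"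
        using X by simp
      also have "\<dots> = (\<integral>\<^sup>+ p. indicator X (T p) \<partial>(?A \<Otimes>\<^sub>M ?A))"
        by (rule nn_integral_distr[OF T]) (use X in auto)
      finally show ?thesis .
    qed
    show "emeasure (distr (?A \<Otimes>\<^sub>M ?A) ?B ?T1) X = emeasure N X"
      unfolding N_def e[OF T1] e[OF T2] using nn_integral_angle_rotate[of "indicator X"] X by simp
  qed (simp add: N_def)
  have fN: "finite_measure N" unfolding N_def by (rule AA.finite_measure_distr[OF T2])
  have sA: "sigma_finite_measure ?A" by unfold_locales
  have sN: "sigma_finite_measure N" using fN by (simp add: finite_measure_def)
  have eq: "distr (?A \<Otimes>\<^sub>M ?A) N T = distr (?A \<Otimes>\<^sub>M ?A) ?B T" for T
    by (rule distr_cong) (simp_all add: sets_N)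
  have sP: "sets (PiM \<Lambda> (\<lambda>_. N)) = sets (PiM \<Lambda> (\<lambda>_. ?B))"
    by (intro sets_PiM_cong) (simp_all add: sets_N)
  have gN: "g \<in> borel_measurable (PiM \<Lambda> (\<lambda>_. N))"
    using g by (simp cong: measurable_cong_sets add: sP)
  have int: "(\<integral>p. g (\<lambda>i\<in>\<Lambda>. T (fst p i, snd p i)) \<partial>(PiM \<Lambda> (\<lambda>_. ?A) \<Otimes>\<^sub>M PiM \<Lambda> (\<lambda>_. ?A))) = integral\<^sup>L (PiM \<Lambda> (\<lambda>_. N)) g"
    if T [measurable]: "T \<in> ?A \<Otimes>\<^sub>M ?A \<rightarrow>\<^sub>M ?B" and "distr (?A \<Otimes>\<^sub>M ?A) ?B T = N" for T
  proof -
    have TN [measurable]: "T \<in> ?A \<Otimes>\<^sub>M ?A \<rightarrow>\<^sub>M N" using T by (simp cong: measurable_cong_sets add: sets_N)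
    have "distr (PiM \<Lambda> (\<lambda>_. ?A) \<Otimes>\<^sub>M PiM \<Lambda> (\<lambda>_. ?A)) (PiM \<Lambda> (\<lambda>_. N)) (\<lambda>p. \<lambda>i\<in>\<Lambda>. T (fst p i, snd p i)) = PiM \<Lambda> (\<lambda>_. N)"
      by (rule PiM_distr_pair[OF \<Lambda> sA sA sN TN]) (simp add: eq that)
    moreover have "integral\<^sup>L (distr (PiM \<Lambda> (\<lambda>_. ?A) \<Otimes>\<^sub>M PiM \<Lambda> (\<lambda>_. ?A)) (PiM \<Lambda> (\<lambda>_. N)) (\<lambda>p. \<lambda>i\<in>\<Lambda>. T (fst p i, snd p i))) g
        = (\<integral>p. g (\<lambda>i\<in>\<Lambda>. T (fst p i, snd p i)) \<partial>(PiM \<Lambda> (\<lambda>_. ?A) \<Otimes>\<^sub>M PiM \<Lambda> (\<lambda>_. ?A)))"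
      by (rule integral_distr[OF _ gN]) measurable
    ultimately show ?thesis by simp
  qed
  show ?thesis
    using int[OF T1 N1] int[OF T2 N_def[symmetric]] by simp
qed

section \<open>Positive kernels of finite rank\<close>

text \<open>Explicit finite sums of squares F(s) F(t) replace positive semidefiniteness: closure
  under products is then mere expansion, and positivity of the double integral is visible term by
  term. The bounds on F make every kernel bounded, hence integrable over a finite measure and usable
  under dominated convergence.\<close>

inductive psd_kernel :: "'b measure \<Rightarrow> ('b \<Rightarrow> 'b \<Rightarrow> real) \<Rightarrow> bool" for M where
  zero: "psd_kernel M (\<lambda>_ _. 0)"
| rank_one_add: "F \<in> borel_measurable M \<Longrightarrow> (\<And>s. \<bar>F s\<bar> \<le> C) \<Longrightarrow> psd_kernel M k
    \<Longrightarrow> psd_kernel M (\<lambda>s t. F s * F t + k s t)"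

lemma psd_kernel_rank_one:
  assumes "F \<in> borel_measurable M" "\<And>s. \<bar>F s\<bar> \<le> C"
  shows "psd_kernel M (\<lambda>s t. F s * F t)"
  using psd_kernel.rank_one_add[OF assms psd_kernel.zero] by simp

lemma psd_kernel_add:
  assumes "psd_kernel M k" and l: "psd_kernel M l"
  shows "psd_kernel M (\<lambda>s t. k s t + l s t)"
  using assms(1)
proof induction
  case (rank_one_add F C k)
  show ?case
    using psd_kernel.rank_one_add[OF rank_one_add(1,2,4)] by (simp add: add.assoc)
qed (simp add: l)

lemma psd_kernel_sum:
  "(\<And>i. i \<in> I \<Longrightarrow> psd_kernel M (k i)) \<Longrightarrow> psd_kernel M (\<lambda>s t. \<Sum>i\<in>I. k i s t)"
  by (induction I rule: infinite_finite_induct) (auto intro: psd_kernel.zero psd_kernel_add)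

lemma psd_kernel_rank_one_mult:
  assumes "psd_kernel M k" and [measurable]: "F \<in> borel_measurable M" and F: "\<And>s. \<bar>F s\<bar> \<le> C"
  shows "psd_kernel M (\<lambda>s t. (F s * F t) * k s t)"
  using assms(1)
proof induction
  case zero
  then show ?case by (simp add: psd_kernel.zero)
next
  case (rank_one_add G D k)
  note [measurable] = rank_one_add(1)
  have "\<bar>F s * G s\<bar> \<le> C * D" for s
    unfolding abs_mult using F[of s] rank_one_add(2)[of s] by (intro mult_mono) auto
  then have "psd_kernel M (\<lambda>s t. (F s * G s) * (F t * G t) + (F s * F t) * k s t)"
    by (intro psd_kernel.rank_one_add[OF _ _ rank_one_add(4)]) auto
  then show ?case by (simp add: algebra_simps)
qed

text \<open>The product of F(s) F(t) and G(s) G(t) is the rank-one kernel of FG; this is the Schur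
  product theorem for finite-rank sums.\<close>

lemma psd_kernel_mult:
  assumes "psd_kernel M k" "psd_kernel M l"
  shows "psd_kernel M (\<lambda>s t. k s t * l s t)"
  using assms(1)
proof induction
  case zero
  then show ?case by (simp add: psd_kernel.zero)
next
  case (rank_one_add F C k)
  have "psd_kernel M (\<lambda>s t. (F s * F t) * l s t + k s t * l s t)"
    by (rule psd_kernel_add[OF psd_kernel_rank_one_mult[OF assms(2) rank_one_add(1,2)] rank_one_add(4)])
  then show ?case by (simp add: algebra_simps)
qed

text \<open>A nonnegative constant is the rank-one kernel of the constant function
  \<open>sqrt c\<close>.\<close>

lemma psd_kernel_cmult:
  assumes "psd_kernel M k" "0 \<le> c"
  shows "psd_kernel M (\<lambda>s t. c * k s t)"
  using psd_kernel_rank_one_mult[OF assms(1), of "\<lambda>_. sqrt c" "sqrt c"] assms(2) by simp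

lemma psd_kernel_power:
  assumes "psd_kernel M k"
  shows "psd_kernel M (\<lambda>s t. k s t ^ n)"
proof (induction n)
  case 0
  then show ?case using psd_kernel_rank_one[of "\<lambda>_. 1" M 1] by simp
next
  case (Suc n)
  then show ?case using psd_kernel_mult[OF assms Suc] by simp
qed

lemma psd_kernel_bounded:
  assumes "psd_kernel M k"
  obtains B where "\<And>s t. \<bar>k s t\<bar> \<le> B"
proof -
  from assms have "\<exists>B. \<forall>s t. \<bar>k s t\<bar> \<le> B"
  proof induction
    case (rank_one_add F C k)
    then obtain B where B: "\<And>s t. \<bar>k s t\<bar> \<le> B" by blast
    have "\<bar>F s * F t + k s t\<bar> \<le> C * C + B" for s t
    proof -
      have "\<bar>F s * F t\<bar> \<le> C * C"
        unfolding abs_mult using rank_one_add(2)[of s] rank_one_add(2)[of t] by (intro mult_mono) auto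
      then show ?thesis using B[of s t] by linarith
    qed
    then show ?case by blast
  qed auto
  then show ?thesis using that by blast
qed

lemma psd_kernel_measurable:
  assumes "psd_kernel M k"
  shows "(\<lambda>p. k (fst p) (snd p)) \<in> borel_measurable (M \<Otimes>\<^sub>M M)"
  using assms
proof induction
  case (rank_one_add F C k)
  note [measurable] = rank_one_add(1,4)
  show ?case by measurable
qed simp

lemma psd_kernel_integrable:
  assumes "finite_measure M" "psd_kernel M k"
  shows "integrable (M \<Otimes>\<^sub>M M) (\<lambda>p. k (fst p) (snd p))"
proof -
  interpret finite_measure "M \<Otimes>\<^sub>M M" by (intro finite_measure_pair_measure assms)
  obtain B where "\<And>s t. \<bar>k s t\<bar> \<le> B" using psd_kernel_bounded[OF assms(2)] by blast
  then show ?thesis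
    by (intro integrable_const_bound[where B=B] psd_kernel_measurable[OF assms(2)]) auto
qed

lemma psd_kernel_integral_nonneg:
  assumes M: "finite_measure M" and "psd_kernel M k"
  shows "0 \<le> (\<integral>p. k (fst p) (snd p) \<partial>(M \<Otimes>\<^sub>M M))"
  using assms(2)
proof induction
  case (rank_one_add F C k)
  interpret M: finite_measure M by fact
  interpret MM: pair_sigma_finite M M ..
  have int: "integrable (M \<Otimes>\<^sub>M M) (\<lambda>p. F (fst p) * F (snd p))"
    using psd_kernel_integrable[OF M psd_kernel_rank_one[OF rank_one_add(1,2)]] .
  have "(\<integral>p. F (fst p) * F (snd p) \<partial>(M \<Otimes>\<^sub>M M)) = (\<integral>s. \<integral>t. F s * F t \<partial>M \<partial>M)"
    using MM.integral_fst'[OF int] by simp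
  also have "\<dots> = (\<integral>t. F t \<partial>M)\<^sup>2" by (simp add: power2_eq_square)
  finally have "0 \<le> (\<integral>p. F (fst p) * F (snd p) \<partial>(M \<Otimes>\<^sub>M M))" by simp
  then show ?case
    using int psd_kernel_integrable[OF M rank_one_add(3)] rank_one_add(4) by simp
qed simp

text \<open>The exponential leaves the finite-rank class, but its Taylor partial sums do not. They
  are dominated by \<open>L * exp B\<close>, so nonnegativity of their integrals passes to the
  limit.\<close>

lemma psd_kernel_exp_integral_nonneg:
  assumes M: "finite_measure M" and k: "psd_kernel M k" and l: "psd_kernel M l"
  shows "0 \<le> (\<integral>p. l (fst p) (snd p) * exp (k (fst p) (snd p)) \<partial>(M \<Otimes>\<^sub>M M))"
proof -
  interpret MM: finite_measure "M \<Otimes>\<^sub>M M" by (intro finite_measure_pair_measure M)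
  obtain B where B: "\<And>s t. \<bar>k s t\<bar> \<le> B" using psd_kernel_bounded[OF k] by blast
  obtain L where L: "\<And>s t. \<bar>l s t\<bar> \<le> L" using psd_kernel_bounded[OF l] by blast
  define a where "a n s t = l s t * (\<Sum>i<n. k s t ^ i / fact i)" for n s t
  have psd: "psd_kernel M (a n)" for n
  proof -
    have "psd_kernel M (\<lambda>s t. l s t * (\<Sum>i<n. (1 / fact i) * k s t ^ i))"
      by (intro psd_kernel_mult psd_kernel_sum psd_kernel_cmult psd_kernel_power k l) auto
    then show ?thesis by (simp add: a_def[abs_def])
  qed
  note [measurable] = psd_kernel_measurable[OF k] psd_kernel_measurable[OF l] psd_kernel_measurable[OF psd]
  have "(\<lambda>n. \<integral>p. a n (fst p) (snd p) \<partial>(M \<Otimes>\<^sub>M M))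
      \<longlonglongrightarrow> (\<integral>p. l (fst p) (snd p) * exp (k (fst p) (snd p)) \<partial>(M \<Otimes>\<^sub>M M))"
  proof (rule integral_dominated_convergence[where w="\<lambda>_. L * exp B"])
    have "(\<lambda>n. \<Sum>i<n. k s t ^ i / fact i) \<longlonglongrightarrow> exp (k s t)" for s t
      using exp_converges[of "k s t"] by (simp add: sums_def divide_inverse mult.commute)
    then show "AE p in M \<Otimes>\<^sub>M M. (\<lambda>n. a n (fst p) (snd p)) \<longlonglongrightarrow> l (fst p) (snd p) * exp (k (fst p) (snd p))"
      unfolding a_def by (intro AE_I2 tendsto_intros)
    show "AE p in M \<Otimes>\<^sub>M M. norm (a n (fst p) (snd p)) \<le> L * exp B" for n
    proof (rule AE_I2)
      fix p
      let ?k = "k (fst p) (snd p)" and ?l = "l (fst p) (snd p)"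
      have "\<bar>\<Sum>i<n. ?k ^ i / fact i\<bar> \<le> (\<Sum>i<n. \<bar>?k ^ i / fact i\<bar>)" by (rule sum_abs)
      also have "\<dots> \<le> (\<Sum>i<n. B ^ i / fact i)"
        using B by (intro sum_mono) (auto simp: abs_mult power_abs intro!: divide_right_mono power_mono)
      also have "\<dots> \<le> exp B"
      proof -
        have B0: "0 \<le> B" using B[of "fst p" "snd p"] by linarith
        have "(\<lambda>i. B ^ i / fact i) sums exp B"
          using exp_converges[of B] by (simp add: divide_inverse mult.commute)
        from sum_le_suminf[OF sums_summable[OF this], of "{..<n}"] sums_unique[OF this] B0 show ?thesis by simp
      qed
      finally have "\<bar>?l\<bar> * \<bar>\<Sum>i<n. ?k ^ i / fact i\<bar> \<le> L * exp B"
        using L[of "fst p" "snd p"] by (intro mult_mono) auto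
      then show "norm (a n (fst p) (snd p)) \<le> L * exp B" by (simp add: a_def abs_mult)
    qed
  qed measurable
  then show ?thesis
    by (rule LIMSEQ_le_const) (use psd_kernel_integral_nonneg[OF M psd] in auto)
qed

lemma integral_pair_mult:
  fixes f g :: "'b \<Rightarrow> real"
  assumes M: "finite_measure M"
    and f [measurable]: "f \<in> borel_measurable M" and g [measurable]: "g \<in> borel_measurable M"
    and fb: "\<And>s. \<bar>f s\<bar> \<le> B" and gb: "\<And>s. \<bar>g s\<bar> \<le> C"
  shows "integrable (M \<Otimes>\<^sub>M M) (\<lambda>p. f (fst p) * g (snd p))"
    and "(\<integral>p. f (fst p) * g (snd p) \<partial>(M \<Otimes>\<^sub>M M)) = integral\<^sup>L M f * integral\<^sup>L M g"
proof -
  interpret M: finite_measure M by fact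
  interpret MM: pair_sigma_finite M M ..
  interpret F: finite_measure "M \<Otimes>\<^sub>M M" by (intro finite_measure_pair_measure M)
  have "\<bar>f s * g t\<bar> \<le> B * C" for s t
    unfolding abs_mult using fb[of s] gb[of t] by (intro mult_mono) auto
  then show int: "integrable (M \<Otimes>\<^sub>M M) (\<lambda>p. f (fst p) * g (snd p))"
    by (intro F.integrable_const_bound[where B="B*C"]) auto
  have "(\<integral>p. f (fst p) * g (snd p) \<partial>(M \<Otimes>\<^sub>M M)) = (\<integral>s. \<integral>t. f s * g t \<partial>M \<partial>M)"
    using MM.integral_fst'[OF int] by simp
  then show "(\<integral>p. f (fst p) * g (snd p) \<partial>(M \<Otimes>\<^sub>M M)) = integral\<^sup>L M f * integral\<^sup>L M g"
    by simp
qed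

section \<open>Ginibre's inequality for the XY model\<close>

lemma abs_pair_sum_le:
  assumes "\<And>u v. \<bar>g u v\<bar> \<le> h u v"
  shows "\<bar>pair_sum \<Lambda> g\<bar> \<le> pair_sum \<Lambda> h"
proof -
  have "\<bar>\<Sum>u\<in>\<Lambda>. \<Sum>v\<in>\<Lambda> - {u}. g u v\<bar> \<le> (\<Sum>u\<in>\<Lambda>. \<Sum>v\<in>\<Lambda> - {u}. h u v)"
    by (intro order_trans[OF sum_abs] sum_mono assms)
  then show ?thesis by (simp add: pair_sum_def)
qed

lemma pair_sum_add: "pair_sum \<Lambda> (\<lambda>u v. g u v + h u v) = pair_sum \<Lambda> g + pair_sum \<Lambda> h"
  by (simp add: pair_sum_def sum.distrib algebra_simps)

lemma pair_sum_cong: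
  assumes "\<And>u v. u \<in> \<Lambda> \<Longrightarrow> v \<in> \<Lambda> \<Longrightarrow> u \<noteq> v \<Longrightarrow> g u v = h u v"
  shows "pair_sum \<Lambda> g = pair_sum \<Lambda> h"
  unfolding pair_sum_def using assms by (intro arg_cong2[where f="(*)"] sum.cong refl) auto

abbreviation angle_PiM :: "'a set \<Rightarrow> ('a \<Rightarrow> real) measure" where
  "angle_PiM \<Lambda> \<equiv> PiM \<Lambda> (\<lambda>_. angle_measure)"

definition XY_weight :: "'a set \<Rightarrow> ('a \<Rightarrow> 'a \<Rightarrow> real) \<Rightarrow> ('a \<Rightarrow> real) \<Rightarrow> real" where
  "XY_weight \<Lambda> K \<theta> = exp (pair_sum \<Lambda> (\<lambda>u v. K u v * cos (\<theta> u - \<theta> v)))"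

lemma finite_measure_PiM:
  assumes "finite \<Lambda>" "finite_measure M"
  shows "finite_measure (PiM \<Lambda> (\<lambda>_. M))"
proof -
  interpret finite_measure M by fact
  interpret product_sigma_finite "\<lambda>_. M" by unfold_locales
  have "emeasure (PiM \<Lambda> (\<lambda>_. M)) (space (PiM \<Lambda> (\<lambda>_. M))) = (\<Prod>i\<in>\<Lambda>. emeasure M (space M))"
    unfolding space_PiM by (rule emeasure_PiM[OF assms(1)]) simp
  then show ?thesis
    by (intro finite_measureI) (simp add: power_eq_top_ennreal)
qed

lemma emeasure_PiM_space_neq_0:
  assumes "finite \<Lambda>" "finite_measure M" "emeasure M (space M) \<noteq> 0"
  shows "emeasure (PiM \<Lambda> (\<lambda>_. M)) (space (PiM \<Lambda> (\<lambda>_. M))) \<noteq> 0"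
proof -
  interpret finite_measure M by fact
  interpret product_sigma_finite "\<lambda>_. M" by unfold_locales
  have "emeasure (PiM \<Lambda> (\<lambda>_. M)) (space (PiM \<Lambda> (\<lambda>_. M))) = (\<Prod>i\<in>\<Lambda>. emeasure M (space M))"
    unfolding space_PiM by (rule emeasure_PiM[OF assms(1)]) simp
  then show ?thesis using assms by simp
qed

lemma integral_pos:
  fixes f :: "'b \<Rightarrow> real"
  assumes "integrable M f" "\<And>s. 0 < f s" "emeasure M (space M) \<noteq> 0"
  shows "0 < integral\<^sup>L M f"
proof -
  have "0 \<le> integral\<^sup>L M f" using assms(2) by (intro integral_nonneg_AE) (auto intro: less_imp_le)
  moreover have "integral\<^sup>L M f \<noteq> 0"
  proof
    assume "integral\<^sup>L M f = 0"
    then have "AE s in M. f s = 0"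
      using integral_nonneg_eq_0_iff_AE[OF assms(1)] assms(2) by (simp add: less_imp_le)
    then have "AE s in M. False" by eventually_elim (use assms(2) in \<open>metis less_irrefl\<close>)
    then have "emeasure M (space M) = 0"
      using AE_iff_measurable[of "space M" M "\<lambda>_. False"] by simp
    with assms(3) show False by simp
  qed
  ultimately show ?thesis by simp
qed

lemma borel_measurable_exp_pair_sum:
  assumes "\<And>u v. u \<in> \<Lambda> \<Longrightarrow> v \<in> \<Lambda> \<Longrightarrow> (\<lambda>s. g s u v) \<in> borel_measurable M"
  shows "(\<lambda>s. exp (pair_sum \<Lambda> (g s))) \<in> borel_measurable M"
proof -
  have [measurable]: "(\<lambda>s. \<Sum>u\<in>\<Lambda>. \<Sum>v\<in>\<Lambda> - {u}. g s u v) \<in> borel_measurable M"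
    by (intro borel_measurable_sum assms) auto
  show ?thesis unfolding pair_sum_def by measurable
qed

lemma angle_component_measurable [measurable]:
  assumes "u \<in> \<Lambda>"
  shows "(\<lambda>\<theta>. \<theta> u) \<in> borel_measurable (angle_PiM \<Lambda>)"
  using borel_measurable_angle by (rule measurable_compose[OF measurable_component_singleton[OF assms]])

lemma XY_weight_measurable [measurable]: "XY_weight \<Lambda> K \<in> borel_measurable (angle_PiM \<Lambda>)"
  unfolding XY_weight_def[abs_def] by (intro borel_measurable_exp_pair_sum) measurable

lemma XY_weight_bounded: "\<bar>XY_weight \<Lambda> K \<theta>\<bar> \<le> exp (pair_sum \<Lambda> (\<lambda>u v. \<bar>K u v\<bar>))"
proof -
  have "\<bar>K u v * cos (\<theta> u - \<theta> v)\<bar> \<le> \<bar>K u v\<bar>" for u v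
    using mult_left_mono[OF abs_cos_le_one[of "\<theta> u - \<theta> v"], of "\<bar>K u v\<bar>"] by (simp add: abs_mult)
  then have "\<bar>pair_sum \<Lambda> (\<lambda>u v. K u v * cos (\<theta> u - \<theta> v))\<bar> \<le> pair_sum \<Lambda> (\<lambda>u v. \<bar>K u v\<bar>)"
    by (rule abs_pair_sum_le)
  then show ?thesis by (simp add: XY_weight_def)
qed

text \<open>The two copies carry different couplings. In half-angle variables s, t a bond
  contributes (J + K) cos cos + (J - K) sin sin and the observable (1 + c) cos cos + (1 - c) sin
  sin, so both are positive kernels exactly when these coefficients are nonnegative.\<close>

lemma XY_ginibre_nonneg:
  assumes \<Lambda>: "finite \<Lambda>" and x: "x \<in> \<Lambda>" and y: "y \<in> \<Lambda>"
    and JK: "\<And>u v. u \<in> \<Lambda> \<Longrightarrow> v \<in> \<Lambda> \<Longrightarrow> u \<noteq> v \<Longrightarrow> \<bar>K u v\<bar> \<le> J u v"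
    and c: "\<bar>c\<bar> \<le> 1"
  shows "0 \<le> (\<integral>p. (cos (real m * (fst p x - fst p y)) + c * cos (real m * (snd p x - snd p y)))
                 * (XY_weight \<Lambda> J (fst p) * XY_weight \<Lambda> K (snd p)) \<partial>(angle_PiM \<Lambda> \<Otimes>\<^sub>M angle_PiM \<Lambda>))"
proof -
  let ?P = "angle_PiM \<Lambda>"
  have fin: "finite_measure ?P" by (intro finite_measure_PiM \<Lambda> finite_measure_angle)
  define k where "k s t = pair_sum \<Lambda> (\<lambda>u v. (J u v + K u v) * (cos (s u - s v) * cos (t u - t v))
      + (J u v - K u v) * (sin (s u - s v) * sin (t u - t v)))" for s t :: "'a \<Rightarrow> real"
  define l where "l s t = (1 + c) * (cos (real m * (s x - s y)) * cos (real m * (t x - t y)))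
      + (1 - c) * (sin (real m * (s x - s y)) * sin (real m * (t x - t y)))" for s t :: "'a \<Rightarrow> real"
  \<comment> \<open>The coupling hypothesis enters here: |K| \<le> J makes both J + K and J - K
    nonnegative.\<close>
  have psd_k: "psd_kernel ?P k"
  proof -
    have "psd_kernel ?P (\<lambda>s t. (J u v + K u v) * (cos (s u - s v) * cos (t u - t v))
      + (J u v - K u v) * (sin (s u - s v) * sin (t u - t v)))" if "u \<in> \<Lambda>" "v \<in> \<Lambda> - {u}" for u v
      using that JK[of u v]
      by (intro psd_kernel_add psd_kernel_cmult psd_kernel_rank_one[where C=1]) (auto intro: borel_measurable_cos borel_measurable_sin)
    then show ?thesis
      unfolding k_def[abs_def] pair_sum_def
      by (intro psd_kernel_cmult psd_kernel_sum) auto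
  qed
  have psd_l: "psd_kernel ?P l"
    unfolding l_def[abs_def] using x y c
    by (intro psd_kernel_add psd_kernel_cmult psd_kernel_rank_one[where C=1]) auto
  \<comment> \<open>The integrand as a function on the torus; the integer power yields cos(m .) by
    De Moivre. Evaluated at the angles it is the wanted integrand (\<open>g1\<close>), at
    differences and sums it is the positive kernel (\<open>g2\<close>).\<close>
  define g :: "('a \<Rightarrow> complex \<times> complex) \<Rightarrow> real" where
    "g z = (Re ((fst (z x) * cnj (fst (z y))) ^ m) + c * Re ((snd (z x) * cnj (snd (z y))) ^ m))
      * exp (pair_sum \<Lambda> (\<lambda>u v. J u v * Re (fst (z u) * cnj (fst (z v))) + K u v * Re (snd (z u) * cnj (snd (z v)))))" for z
  let ?Q = "PiM \<Lambda> (\<lambda>_. borel \<Otimes>\<^sub>M borel) :: ('a \<Rightarrow> complex \<times> complex) measure"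
  have Re_cnj [measurable]: "Re \<in> borel_measurable borel" "cnj \<in> borel_measurable borel"
    by (intro borel_measurable_continuous_onI continuous_intros)+
  have g: "g \<in> borel_measurable ?Q"
  proof -
    have e: "(\<lambda>z. exp (pair_sum \<Lambda> (\<lambda>u v. J u v * Re (fst (z u) * cnj (fst (z v))) + K u v * Re (snd (z u) * cnj (snd (z v))))))
        \<in> borel_measurable ?Q"
      by (intro borel_measurable_exp_pair_sum) measurable
    have c: "(\<lambda>z. fst (z u)) \<in> borel_measurable ?Q" "(\<lambda>z. snd (z u)) \<in> borel_measurable ?Q"
      "(\<lambda>z. cnj (fst (z u))) \<in> borel_measurable ?Q" "(\<lambda>z. cnj (snd (z u))) \<in> borel_measurable ?Q"
      if [measurable]: "u \<in> \<Lambda>" for u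
      by measurable
    have r: "(\<lambda>z. Re ((fst (z x) * cnj (fst (z y))) ^ m)) \<in> borel_measurable ?Q"
       "(\<lambda>z. Re ((snd (z x) * cnj (snd (z y))) ^ m)) \<in> borel_measurable ?Q"
      by (intro measurable_compose[OF _ Re_cnj(1)] borel_measurable_power borel_measurable_times c x y)+
    show ?thesis unfolding g_def[abs_def]
      by (intro borel_measurable_times borel_measurable_add borel_measurable_const r e)
  qed
  have cis_diff: "cis a * cnj (cis b) = cis (a - b)" for a b
    by (simp add: cis_cnj cis_mult)
  have Re_cis: "Re (cis a ^ n) = cos (real n * a)" for a n
    by (simp only: Complex.DeMoivre cis.sel)
  have g1: "g (\<lambda>i\<in>\<Lambda>. (cis (a i), cis (b i)))
      = (cos (real m * (a x - a y)) + c * cos (real m * (b x - b y))) * (XY_weight \<Lambda> J a * XY_weight \<Lambda> K b)" for a b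
  proof -
    have "pair_sum \<Lambda> (\<lambda>u v. J u v * Re (fst ((\<lambda>i\<in>\<Lambda>. (cis (a i), cis (b i))) u) * cnj (fst ((\<lambda>i\<in>\<Lambda>. (cis (a i), cis (b i))) v)))
        + K u v * Re (snd ((\<lambda>i\<in>\<Lambda>. (cis (a i), cis (b i))) u) * cnj (snd ((\<lambda>i\<in>\<Lambda>. (cis (a i), cis (b i))) v))))
      = pair_sum \<Lambda> (\<lambda>u v. J u v * cos (a u - a v) + K u v * cos (b u - b v))"
      by (rule pair_sum_cong) (simp add: cis_diff)
    then show ?thesis
      using x y unfolding g_def XY_weight_def exp_add[symmetric] pair_sum_add[symmetric] by (simp add: cis_diff Re_cis)
  qed
  have g2: "g (\<lambda>i\<in>\<Lambda>. (cis (s i - t i), cis (s i + t i))) = l s t * exp (k s t)" for s t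
  proof -
    \<comment> \<open>One identity serves the observable, with weights 1 and c (hence the explicit
      factor 1 below), and each bond, with weights J and K.\<close>
    have *: "a * cos (p - q - (p' - q')) + b * cos (p + q - (p' + q'))
      = (a + b) * (cos (p - p') * cos (q - q')) + (a - b) * (sin (p - p') * sin (q - q'))" for a b p q p' q' :: real
    proof -
      have "p - q - (p' - q') = (p - p') - (q - q')" "p + q - (p' + q') = (p - p') + (q - q')" by auto
      then show ?thesis by (simp only: cos_add cos_diff) (simp add: algebra_simps)
    qed
    have "real m * (s x - t x - (s y - t y)) = real m * s x - real m * t x - (real m * s y - real m * t y)"
         "real m * (s x + t x - (s y + t y)) = real m * s x + real m * t x - (real m * s y + real m * t y)"
      by (simp_all add: algebra_simps)
    then have "1 * cos (real m * (s x - t x - (s y - t y))) + c * cos (real m * (s x + t x - (s y + t y))) = l s t"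
      unfolding l_def by (simp only: * right_diff_distrib)
    moreover have "XY_weight \<Lambda> J (\<lambda>i. s i - t i) * XY_weight \<Lambda> K (\<lambda>i. s i + t i) = exp (k s t)"
      unfolding XY_weight_def exp_add[symmetric] pair_sum_add[symmetric] k_def * ..
    ultimately show ?thesis unfolding g1 by simp
  qed
  have "0 \<le> (\<integral>p. l (fst p) (snd p) * exp (k (fst p) (snd p)) \<partial>(?P \<Otimes>\<^sub>M ?P))"
    by (rule psd_kernel_exp_integral_nonneg[OF fin psd_k psd_l])
  also have "\<dots> = (\<integral>p. g (\<lambda>i\<in>\<Lambda>. (cis (fst p i - snd p i), cis (fst p i + snd p i))) \<partial>(?P \<Otimes>\<^sub>M ?P))"
    unfolding g2 ..
  also have "\<dots> = (\<integral>p. g (\<lambda>i\<in>\<Lambda>. (cis (fst p i), cis (snd p i))) \<partial>(?P \<Otimes>\<^sub>M ?P))"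
    by (rule integral_angle_rotate_PiM[OF \<Lambda> g])
  finally show ?thesis unfolding g1 .
qed

lemma XY_obs_measurable:
  assumes "x \<in> \<Lambda>" "y \<in> \<Lambda>"
  shows "(\<lambda>\<theta>. cos (real m * (\<theta> x - \<theta> y)) * XY_weight \<Lambda> K \<theta>) \<in> borel_measurable (angle_PiM \<Lambda>)"
  using assms by (intro borel_measurable_times) auto

lemma XY_obs_bounded:
  "\<bar>cos (real m * (\<theta> x - \<theta> y)) * XY_weight \<Lambda> K \<theta>\<bar> \<le> exp (pair_sum \<Lambda> (\<lambda>u v. \<bar>K u v\<bar>))"
proof -
  have "\<bar>cos (real m * (\<theta> x - \<theta> y))\<bar> * \<bar>XY_weight \<Lambda> K \<theta>\<bar> \<le> 1 * exp (pair_sum \<Lambda> (\<lambda>u v. \<bar>K u v\<bar>))"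
    by (intro mult_mono XY_weight_bounded) auto
  then show ?thesis by (simp add: abs_mult)
qed

text \<open>The duplicated integral splits as N_J Z_K + c Z_J N_K, where N and Z are numerator and
  partition function; c = 1 and c = -1 bound Z_J N_K from both sides and so give the absolute
  value.\<close>

lemma XY_ginibre:
  assumes \<Lambda>: "finite \<Lambda>" and x: "x \<in> \<Lambda>" and y: "y \<in> \<Lambda>"
    and JK: "\<And>u v. u \<in> \<Lambda> \<Longrightarrow> v \<in> \<Lambda> \<Longrightarrow> u \<noteq> v \<Longrightarrow> \<bar>K u v\<bar> \<le> J u v"
  shows "\<bar>\<integral>\<theta>. cos (real m * (\<theta> x - \<theta> y)) * XY_weight \<Lambda> K \<theta> \<partial>angle_PiM \<Lambda>\<bar> * integral\<^sup>L (angle_PiM \<Lambda>) (XY_weight \<Lambda> J)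
      \<le> (\<integral>\<theta>. cos (real m * (\<theta> x - \<theta> y)) * XY_weight \<Lambda> J \<theta> \<partial>angle_PiM \<Lambda>) * integral\<^sup>L (angle_PiM \<Lambda>) (XY_weight \<Lambda> K)"
proof -
  let ?P = "angle_PiM \<Lambda>"
  let ?N = "\<lambda>K. \<integral>\<theta>. cos (real m * (\<theta> x - \<theta> y)) * XY_weight \<Lambda> K \<theta> \<partial>?P"
  let ?Z = "\<lambda>K. integral\<^sup>L ?P (XY_weight \<Lambda> K)"
  have fin: "finite_measure ?P" by (intro finite_measure_PiM \<Lambda> finite_measure_angle)
  note 1 = integral_pair_mult[OF fin XY_obs_measurable[OF x y, of m J] XY_weight_measurable[of \<Lambda> K] XY_obs_bounded XY_weight_bounded]
  note 2 = integral_pair_mult[OF fin XY_weight_measurable[of \<Lambda> J] XY_obs_measurable[OF x y, of m K] XY_weight_bounded XY_obs_bounded]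
  have "0 \<le> ?N J * ?Z K + c * (?Z J * ?N K)" if c: "\<bar>c\<bar> \<le> 1" for c
  proof -
    have "0 \<le> (\<integral>p. (cos (real m * (fst p x - fst p y)) + c * cos (real m * (snd p x - snd p y)))
                 * (XY_weight \<Lambda> J (fst p) * XY_weight \<Lambda> K (snd p)) \<partial>(?P \<Otimes>\<^sub>M ?P))"
      by (rule XY_ginibre_nonneg[OF \<Lambda> x y JK c])
    also have "\<dots> = (\<integral>p. (cos (real m * (fst p x - fst p y)) * XY_weight \<Lambda> J (fst p)) * XY_weight \<Lambda> K (snd p)
        + c * (XY_weight \<Lambda> J (fst p) * (cos (real m * (snd p x - snd p y)) * XY_weight \<Lambda> K (snd p))) \<partial>(?P \<Otimes>\<^sub>M ?P))"
      by (intro Bochner_Integration.integral_cong) (auto simp: algebra_simps)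
    also have "\<dots> = ?N J * ?Z K + c * (?Z J * ?N K)"
      using 1 2 by simp
    finally show ?thesis .
  qed
  from this[of 1] this[of "-1"] have "\<bar>?Z J * ?N K\<bar> \<le> ?N J * ?Z K" by (simp add: abs_le_iff)
  moreover have "0 \<le> ?Z J" by (intro integral_nonneg_AE) (simp add: XY_weight_def)
  ultimately show ?thesis by (simp add: abs_mult mult.commute)
qed

section \<open>Rotation invariance\<close>

text \<open>With the i-coordinate integrated innermost, \<open>v \<bullet> j\<close> is constant
  along it because j differs from i, so the shear acts there as a translation.\<close>

lemma nn_integral_lborel_shear:
  fixes f :: "'b::euclidean_space \<Rightarrow> ennreal"
  assumes f [measurable]: "f \<in> borel_measurable borel" and i: "i \<in> Basis" and j: "j \<in> Basis" and ij: "i \<noteq> j"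
  shows "(\<integral>\<^sup>+ v. f (v + (c * (v \<bullet> j)) *\<^sub>R i) \<partial>lborel) = integral\<^sup>N lborel f"
proof -
  interpret product_sigma_finite "\<lambda>_::'b. lborel :: real measure" by unfold_locales
  let ?B = "Basis - {i} :: 'b set"
  let ?S = "\<lambda>x. \<Sum>b\<in>?B. x b *\<^sub>R b :: 'b"
  have B: "Basis = insert i ?B" using i by auto
  have comb: "(\<lambda>x. \<Sum>b\<in>Basis. x b *\<^sub>R b :: 'b) \<in> borel_measurable (PiM Basis (\<lambda>_. lborel))"
  proof (intro borel_measurable_sum borel_measurable_scaleR borel_measurable_const)
    fix b :: 'b assume "b \<in> Basis"
    then show "(\<lambda>x. x b) \<in> borel_measurable (PiM Basis (\<lambda>_. lborel))"
      using measurable_component_singleton[of b Basis "\<lambda>_. lborel"] by simp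
  qed
  have iterate: "integral\<^sup>N lborel g = (\<integral>\<^sup>+ x. (\<integral>\<^sup>+ y. g (?S x + y *\<^sub>R i) \<partial>lborel) \<partial>PiM ?B (\<lambda>_. lborel))"
    if g [measurable]: "g \<in> borel_measurable borel" for g :: "'b \<Rightarrow> ennreal"
  proof -
    have "integral\<^sup>N lborel g = (\<integral>\<^sup>+ x. g (\<Sum>b\<in>Basis. x b *\<^sub>R b) \<partial>PiM Basis (\<lambda>_. lborel))"
      by (subst lborel_eq) (rule nn_integral_distr[OF comb], simp)
    also have "\<dots> = (\<integral>\<^sup>+ x. g (\<Sum>b\<in>Basis. x b *\<^sub>R b) \<partial>PiM (insert i ?B) (\<lambda>_. lborel))"
      using B by simp
    also have "\<dots> = (\<integral>\<^sup>+ x. (\<integral>\<^sup>+ y. g (\<Sum>b\<in>Basis. (x(i := y)) b *\<^sub>R b) \<partial>lborel) \<partial>PiM ?B (\<lambda>_. lborel))"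
      using measurable_compose[OF comb g] by (intro product_nn_integral_insert) (simp_all only: B[symmetric], auto)
    also have "\<dots> = (\<integral>\<^sup>+ x. (\<integral>\<^sup>+ y. g (?S x + y *\<^sub>R i) \<partial>lborel) \<partial>PiM ?B (\<lambda>_. lborel))"
    proof (intro nn_integral_cong)
      fix x y
      have "(\<Sum>b\<in>Basis. (x(i := y)) b *\<^sub>R b) = y *\<^sub>R i + (\<Sum>b\<in>?B. (x(i := y)) b *\<^sub>R b)"
        by (subst sum.remove[OF finite_Basis i]) simp
      also have "(\<Sum>b\<in>?B. (x(i := y)) b *\<^sub>R b) = ?S x"
        by (intro sum.cong) auto
      finally show "g (\<Sum>b\<in>Basis. (x(i := y)) b *\<^sub>R b) = g (?S x + y *\<^sub>R i)" by (simp add: add.commute)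
    qed
    finally show ?thesis .
  qed
  have "(\<integral>\<^sup>+ v. f (v + (c * (v \<bullet> j)) *\<^sub>R i) \<partial>lborel)
      = (\<integral>\<^sup>+ x. (\<integral>\<^sup>+ y. f (?S x + y *\<^sub>R i + (c * ((?S x + y *\<^sub>R i) \<bullet> j)) *\<^sub>R i) \<partial>lborel) \<partial>PiM ?B (\<lambda>_. lborel))"
    by (rule iterate) measurable
  also have "\<dots> = (\<integral>\<^sup>+ x. (\<integral>\<^sup>+ y. f (?S x + y *\<^sub>R i) \<partial>lborel) \<partial>PiM ?B (\<lambda>_. lborel))"
  proof (rule nn_integral_cong)
    fix x
    have "(\<integral>\<^sup>+ y. f (?S x + y *\<^sub>R i) \<partial>lborel) = (\<integral>\<^sup>+ y. f (?S x + (c * (?S x \<bullet> j) + y) *\<^sub>R i) \<partial>lborel)"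
      by (subst nn_integral_real_affine[where c=1 and t="c * (?S x \<bullet> j)"]) auto
    also have "\<dots> = (\<integral>\<^sup>+ y. f (?S x + y *\<^sub>R i + (c * ((?S x + y *\<^sub>R i) \<bullet> j)) *\<^sub>R i) \<partial>lborel)"
      using i j ij by (intro nn_integral_cong) (simp add: inner_add_left inner_not_same_Basis algebra_simps)
    finally show "(\<integral>\<^sup>+ y. f (?S x + y *\<^sub>R i + (c * ((?S x + y *\<^sub>R i) \<bullet> j)) *\<^sub>R i) \<partial>lborel)
      = (\<integral>\<^sup>+ y. f (?S x + y *\<^sub>R i) \<partial>lborel)" ..
  qed
  also have "\<dots> = integral\<^sup>N lborel f" by (rule iterate[symmetric, OF f])
  finally show ?thesis .
qed

section \<open>Rotations in a coordinate plane\<close>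

definition plane_rot :: "'n \<Rightarrow> 'n \<Rightarrow> real \<Rightarrow> real ^ 'n \<Rightarrow> real ^ 'n" where
  "plane_rot i j \<phi> v = (\<chi> k. if k = i then cos \<phi> * v $ i - sin \<phi> * v $ j
                       else if k = j then sin \<phi> * v $ i + cos \<phi> * v $ j else v $ k)"

lemma sum_plane_split:
  fixes g :: "'n::finite \<Rightarrow> 'b::comm_monoid_add"
  assumes "i \<noteq> j"
  shows "sum g UNIV = g i + g j + sum g (UNIV - {i, j})"
proof -
  have "sum g UNIV = g i + sum g (UNIV - {i})" by (rule sum.remove) auto
  also have "sum g (UNIV - {i}) = g j + sum g (UNIV - {i} - {j})" using assms by (intro sum.remove) auto
  also have "UNIV - {i} - {j} = UNIV - {i, j}" by auto
  finally show ?thesis by (simp add: add.assoc)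
qed

lemma norm_eq_if_plane_eq:
  fixes v w :: "real ^ 'n"
  assumes "i \<noteq> j" "(w $ i)\<^sup>2 + (w $ j)\<^sup>2 = (v $ i)\<^sup>2 + (v $ j)\<^sup>2"
    and "\<And>k. k \<noteq> i \<Longrightarrow> k \<noteq> j \<Longrightarrow> w $ k = v $ k"
  shows "norm w = norm v"
proof -
  have "(\<Sum>k\<in>UNIV. (w $ k)\<^sup>2) = (\<Sum>k\<in>UNIV. (v $ k)\<^sup>2)"
    unfolding sum_plane_split[OF assms(1)] using assms(2,3) by (auto intro!: arg_cong2[where f="(+)"] sum.cong)
  then show ?thesis by (simp add: norm_vec_def L2_set_def)
qed

lemma norm_plane_rot [simp]: "i \<noteq> j \<Longrightarrow> norm (plane_rot i j \<phi> v) = norm v"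
proof (rule norm_eq_if_plane_eq[of i j])
  have alg: "(c * a - s * b)\<^sup>2 + (s * a + c * b)\<^sup>2 = (c\<^sup>2 + s\<^sup>2) * (a\<^sup>2 + b\<^sup>2)" for a b c s :: real
    by (simp add: power2_eq_square algebra_simps)
  assume "i \<noteq> j"
  then have "(plane_rot i j \<phi> v $ i)\<^sup>2 + (plane_rot i j \<phi> v $ j)\<^sup>2
      = ((cos \<phi>)\<^sup>2 + (sin \<phi>)\<^sup>2) * ((v $ i)\<^sup>2 + (v $ j)\<^sup>2)"
    unfolding alg[symmetric] by (simp add: plane_rot_def)
  then show "(plane_rot i j \<phi> v $ i)\<^sup>2 + (plane_rot i j \<phi> v $ j)\<^sup>2 = (v $ i)\<^sup>2 + (v $ j)\<^sup>2" by simp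
qed (auto simp: plane_rot_def)

lemma plane_rot_scaleR: "plane_rot i j \<phi> (c *\<^sub>R v) = c *\<^sub>R plane_rot i j \<phi> v"
  by (simp add: plane_rot_def vec_eq_iff algebra_simps)

lemma plane_rot_add: "i \<noteq> j \<Longrightarrow> plane_rot i j \<phi> (plane_rot i j \<psi> v) = plane_rot i j (\<phi> + \<psi>) v"
  by (simp add: plane_rot_def vec_eq_iff cos_add sin_add algebra_simps)

lemma plane_rot_periodic: "plane_rot i j (\<phi> + 2 * pi) v = plane_rot i j \<phi> v"
  by (simp add: plane_rot_def vec_eq_iff)

lemma continuous_on_plane_rot:
  fixes U :: "'b::t2_space set"
  assumes "continuous_on U f" "continuous_on U g"
  shows "continuous_on U (\<lambda>s. plane_rot i j (f s) (g s))"
  unfolding plane_rot_def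
proof (rule continuous_on_vec_lambda)
  fix k show "continuous_on U (\<lambda>s. if k = i then cos (f s) * g s $ i - sin (f s) * g s $ j
      else if k = j then sin (f s) * g s $ i + cos (f s) * g s $ j else g s $ k)"
    using assms by (cases "k = i"; cases "k = j") (auto intro!: continuous_intros)
qed

lemma plane_rot_measurable [measurable]:
  "(\<lambda>p. plane_rot i j (fst p) (snd p)) \<in> borel_measurable (borel \<Otimes>\<^sub>M borel)"
  unfolding borel_prod by (intro borel_measurable_continuous_onI continuous_on_plane_rot continuous_intros)

lemma plane_rot_measurable' [measurable]: "plane_rot i j \<phi> \<in> borel_measurable borel"
  by (intro borel_measurable_continuous_onI continuous_on_plane_rot continuous_intros)

text \<open>A rotation is a product of three shears, with parameters \<open>- tan (\<phi>/2)\<close>, \<open>sin \<phi>\<close>, \<open>- tan (\<phi>/2)\<close>;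
  the remaining angles are reached by composing two rotations.\<close>
lemma nn_integral_lborel_plane_rot:
  fixes f :: "real ^ 'n \<Rightarrow> ennreal"
  assumes f: "f \<in> borel_measurable borel" and ij: "i \<noteq> j"
  shows "(\<integral>\<^sup>+ v. f (plane_rot i j \<phi> v) \<partial>lborel) = integral\<^sup>N lborel f"
proof -
  have shears: "(\<integral>\<^sup>+ v. g (plane_rot i j \<phi> v) \<partial>lborel) = integral\<^sup>N lborel g"
    if c: "cos (\<phi> / 2) \<noteq> 0" and g [measurable]: "g \<in> borel_measurable borel" for g :: "real ^ 'n \<Rightarrow> ennreal" and \<phi>
  proof -
    define e where "e k = (axis k 1 :: real ^ 'n)" for k
    have e: "e k \<in> Basis" "e i \<noteq> e j" for k using ij by (auto simp: e_def axis_eq_axis)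
    define t where "t = tan (\<phi> / 2)"
    define A where "A v = v + (- t * (v \<bullet> e j)) *\<^sub>R e i" for v
    define B where "B v = v + (sin \<phi> * (v \<bullet> e i)) *\<^sub>R e j" for v
    have [measurable]: "A \<in> borel_measurable borel" "B \<in> borel_measurable borel"
      unfolding A_def[abs_def] B_def[abs_def] by measurable
    have s2: "sin \<phi> = 2 * sin (\<phi>/2) * cos (\<phi>/2)" and c2: "cos \<phi> = 1 - 2 * (sin (\<phi>/2))\<^sup>2"
      and c2': "cos \<phi> = 2 * (cos (\<phi>/2))\<^sup>2 - 1"
      using sin_double[of "\<phi>/2"] cos_double_sin[of "\<phi>/2"] cos_double_cos[of "\<phi>/2"] by simp_all
    have "t * sin \<phi> = 1 - cos \<phi>" unfolding t_def tan_def s2 c2 using c by (simp add: power2_eq_square)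
    then have t1: "1 - t * sin \<phi> = cos \<phi>" by simp
    have t2: "t * (1 + cos \<phi>) = sin \<phi>" unfolding t_def tan_def s2 c2' using c by (simp add: power2_eq_square)
    have rot: "A (B (A v)) = plane_rot i j \<phi> v" for v
    proof -
      have "A (B (A v)) $ k = plane_rot i j \<phi> v $ k" for k
      proof -
        have "v $ i - t * v $ j - t * (v $ j + sin \<phi> * (v $ i - t * v $ j))
            = (1 - t * sin \<phi>) * v $ i - (t + t * (1 - t * sin \<phi>)) * v $ j" by (simp add: algebra_simps)
        also have "\<dots> = cos \<phi> * v $ i - sin \<phi> * v $ j"
          unfolding t1 using t2 by (simp add: algebra_simps)
        finally have 1: "v $ i - t * v $ j - t * (v $ j + sin \<phi> * (v $ i - t * v $ j)) = cos \<phi> * v $ i - sin \<phi> * v $ j" .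
        have "v $ j + sin \<phi> * (v $ i - t * v $ j) = sin \<phi> * v $ i + (1 - t * sin \<phi>) * v $ j"
          by (simp add: algebra_simps)
        then have 2: "v $ j + sin \<phi> * (v $ i - t * v $ j) = sin \<phi> * v $ i + cos \<phi> * v $ j" unfolding t1 .
        have ax: "e l $ k = (if k = l then 1 else 0)" for k l by (simp add: e_def axis_def)
        have inn: "w \<bullet> e l = w $ l" for w l by (simp add: e_def inner_axis)
        show ?thesis
          using 1 2 ij unfolding A_def B_def inn by (simp add: ax plane_rot_def algebra_simps)
      qed
      then show ?thesis by (simp add: vec_eq_iff)
    qed
    have A: "(\<integral>\<^sup>+ v. h (A v) \<partial>lborel) = integral\<^sup>N lborel h" if "h \<in> borel_measurable borel" for h :: "real ^ 'n \<Rightarrow> ennreal"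
      unfolding A_def using that e by (intro nn_integral_lborel_shear) auto
    have B: "(\<integral>\<^sup>+ v. h (B v) \<partial>lborel) = integral\<^sup>N lborel h" if "h \<in> borel_measurable borel" for h :: "real ^ 'n \<Rightarrow> ennreal"
      unfolding B_def using that e by (intro nn_integral_lborel_shear) (auto dest: sym)
    have "(\<integral>\<^sup>+ v. g (A (B (A v))) \<partial>lborel) = (\<integral>\<^sup>+ v. g (A (B v)) \<partial>lborel)"
      by (rule A[of "\<lambda>v. g (A (B v))"]) measurable
    also have "\<dots> = (\<integral>\<^sup>+ v. g (A v) \<partial>lborel)" by (rule B[of "\<lambda>v. g (A v)"]) measurable
    also have "\<dots> = integral\<^sup>N lborel g" by (rule A) measurable
    finally show ?thesis unfolding rot .
  qed
  show ?thesis
  proof (cases "cos (\<phi> / 2) = 0")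
    case False
    then show ?thesis by (rule shears[OF _ f])
  next
    case True
    have "cos (\<phi> / 2) = 2 * (cos (\<phi> / 2 / 2))\<^sup>2 - 1" using cos_double_cos[of "\<phi>/2/2"] by simp
    with True have c: "cos (\<phi> / 2 / 2) \<noteq> 0" by auto
    note [measurable] = f
    have "(\<integral>\<^sup>+ v. f (plane_rot i j \<phi> v) \<partial>lborel) = (\<integral>\<^sup>+ v. f (plane_rot i j (\<phi>/2) (plane_rot i j (\<phi>/2) v)) \<partial>lborel)"
      using ij by (simp add: plane_rot_add)
    also have "\<dots> = (\<integral>\<^sup>+ v. f (plane_rot i j (\<phi>/2) v) \<partial>lborel)"
      by (rule shears[OF c]) measurable
    also have "\<dots> = integral\<^sup>N lborel f" by (rule shears[OF c f])
    finally show ?thesis .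
  qed
qed

section \<open>The cone measure on the sphere and its rotation invariance\<close>

lemma space_sphere_measure: "space (sphere_measure :: (real ^ 'n) measure) = sphere 0 1"
  by (simp add: sphere_measure_def space_restrict_space)

lemma sets_sphere_measure: "sets (sphere_measure :: (real ^ 'n) measure) = sets (restrict_space borel (sphere 0 1))"
  by (simp add: sphere_measure_def)

lemma sphere_measure_setsD: "X \<in> sets (sphere_measure :: (real ^ 'n) measure) \<Longrightarrow> X \<in> sets borel"
  by (auto simp: sets_sphere_measure sets_restrict_space)

lemma measurable_sphere_measureI:
  fixes f :: "'b \<Rightarrow> real ^ 'n"
  assumes "f \<in> borel_measurable M" "\<And>s. s \<in> space M \<Longrightarrow> norm (f s) = 1"
  shows "f \<in> M \<rightarrow>\<^sub>M sphere_measure"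
proof -
  have "f \<in> M \<rightarrow>\<^sub>M restrict_space borel (sphere 0 1)"
    using assms by (intro measurable_restrict_space2) auto
  then show ?thesis by (simp cong: measurable_cong_sets add: sets_sphere_measure)
qed

lemma borel_measurable_sphere: "(\<lambda>v. v) \<in> borel_measurable (sphere_measure :: (real ^ 'n) measure)"
proof -
  have "(\<lambda>v. v) \<in> restrict_space borel (sphere 0 1 :: (real ^ 'n) set) \<rightarrow>\<^sub>M borel"
    by (intro measurable_restrict_space1) simp
  then show ?thesis by (simp cong: measurable_cong_sets add: sets_sphere_measure)
qed

lemma radial_projection_measurable:
  "(\<lambda>v::real ^ 'n. v /\<^sub>R norm v) \<in> restrict_space lborel (ball 0 1 - {0}) \<rightarrow>\<^sub>M restrict_space borel (sphere 0 1)"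
  by (intro measurable_restrict_space2 measurable_restrict_space1) (auto simp: space_restrict_space)

lemma nn_integral_sphere_measure:
  fixes f :: "real ^ 'n \<Rightarrow> ennreal"
  assumes [measurable]: "f \<in> borel_measurable borel"
  shows "integral\<^sup>N sphere_measure f = (\<integral>\<^sup>+ v. f (v /\<^sub>R norm v) * indicator (ball 0 1 - {0}) v \<partial>lborel)"
proof -
  have "f \<in> borel_measurable (restrict_space borel (sphere 0 1))"
    by (intro measurable_restrict_space1) simp
  then have "integral\<^sup>N sphere_measure f = (\<integral>\<^sup>+ v. f (v /\<^sub>R norm v) \<partial>restrict_space lborel (ball 0 1 - {0}))"
    unfolding sphere_measure_def by (intro nn_integral_distr[OF radial_projection_measurable]) simp
  also have "\<dots> = (\<integral>\<^sup>+ v. f (v /\<^sub>R norm v) * indicator (ball 0 1 - {0}) v \<partial>lborel)"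
    by (intro nn_integral_restrict_space) simp
  finally show ?thesis .
qed

text \<open>The total mass matters only for being finite and nonzero: the first gives integrability
  of bounded observables, the second a positive partition function.\<close>

lemma emeasure_sphere_measure_space:
  "emeasure sphere_measure (space (sphere_measure :: (real ^ 'n) measure)) = emeasure lborel (ball (0 :: real ^ 'n) 1)"
proof -
  have "emeasure sphere_measure (space (sphere_measure :: (real ^ 'n) measure)) = (\<integral>\<^sup>+ v. 1 \<partial>(sphere_measure :: (real ^ 'n) measure))"
    by simp
  also have "\<dots> = (\<integral>\<^sup>+ v. indicator (ball 0 1 - {0}) v \<partial>(lborel :: (real ^ 'n) measure))"
    by (subst nn_integral_sphere_measure) auto
  also have "\<dots> = emeasure lborel (ball 0 1 - {0} :: (real ^ 'n) set)" by simp
  also have "\<dots> = emeasure lborel (ball (0 :: real ^ 'n) 1)"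
    by (intro emeasure_Diff_null_set) (auto simp: null_sets_def)
  finally show ?thesis .
qed

lemma finite_measure_sphere: "finite_measure (sphere_measure :: (real ^ 'n) measure)"
  by (rule finite_measureI)
    (use emeasure_lborel_ball_finite[of "0 :: real ^ 'n" 1] in \<open>simp add: emeasure_sphere_measure_space\<close>)

lemma emeasure_sphere_measure_neq_0:
  "emeasure sphere_measure (space (sphere_measure :: (real ^ 'n) measure)) \<noteq> 0"
proof
  assume "emeasure sphere_measure (space (sphere_measure :: (real ^ 'n) measure)) = 0"
  then have "ball (0 :: real ^ 'n) 1 \<in> null_sets lborel"
    by (simp add: emeasure_sphere_measure_space null_sets_def)
  moreover have "measure lborel (ball (0 :: real ^ 'n) 1) > 0" by simp
  ultimately show False by (simp add: null_sets_def measure_def)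
qed

text \<open>A rotation commutes with radial projection and preserves the punctured ball, so its
  invariance is that of Lebesgue measure.\<close>

lemma nn_integral_sphere_plane_rot:
  fixes f :: "real ^ 'n \<Rightarrow> ennreal"
  assumes f [measurable]: "f \<in> borel_measurable borel" and ij: "i \<noteq> j"
  shows "(\<integral>\<^sup>+ v. f (plane_rot i j \<phi> v) \<partial>sphere_measure) = integral\<^sup>N sphere_measure f"
proof -
  have [measurable]: "(\<lambda>v::real ^ 'n. v /\<^sub>R norm v) \<in> borel_measurable borel"
    by (intro borel_measurable_scaleR borel_measurable_inverse borel_measurable_norm) auto
  have proj: "(\<lambda>v. f (v /\<^sub>R norm v)) \<in> borel_measurable borel"
    by (rule measurable_compose[OF _ f]) measurable
  have meas: "(\<lambda>v. f (v /\<^sub>R norm v) * indicator (ball 0 1 - {0}) v) \<in> borel_measurable borel"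
    by (intro borel_measurable_times_ennreal proj borel_measurable_indicator) auto
  have "(\<integral>\<^sup>+ v. f (plane_rot i j \<phi> v) \<partial>sphere_measure)
    = (\<integral>\<^sup>+ v. f (plane_rot i j \<phi> (v /\<^sub>R norm v)) * indicator (ball 0 1 - {0}) v \<partial>lborel)"
    by (rule nn_integral_sphere_measure[OF measurable_compose[OF plane_rot_measurable' f]])
  also have "\<dots> = (\<integral>\<^sup>+ v. f (plane_rot i j \<phi> v /\<^sub>R norm (plane_rot i j \<phi> v))
      * indicator (ball 0 1 - {0}) (plane_rot i j \<phi> v) \<partial>lborel)"
  proof (intro nn_integral_cong)
    fix v :: "real ^ 'n"
    have "plane_rot i j \<phi> v = 0 \<longleftrightarrow> v = 0"
      using norm_plane_rot[OF ij, of \<phi> v] by (metis norm_eq_zero)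
    then have "indicator (ball 0 1 - {0}) (plane_rot i j \<phi> v) = (indicator (ball 0 1 - {0}) v :: ennreal)"
      using ij by (simp add: indicator_def)
    then show "f (plane_rot i j \<phi> (v /\<^sub>R norm v)) * indicator (ball 0 1 - {0}) v
       = f (plane_rot i j \<phi> v /\<^sub>R norm (plane_rot i j \<phi> v)) * indicator (ball 0 1 - {0}) (plane_rot i j \<phi> v)"
      using ij by (simp add: plane_rot_scaleR)
  qed
  also have "\<dots> = (\<integral>\<^sup>+ v. f (v /\<^sub>R norm v) * indicator (ball 0 1 - {0}) v \<partial>lborel)"
    by (rule nn_integral_lborel_plane_rot[OF meas ij])
  also have "\<dots> = integral\<^sup>N sphere_measure f"
    by (rule nn_integral_sphere_measure[OF f, symmetric])
  finally show ?thesis .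
qed

section \<open>Resampling the polar angle in a coordinate plane\<close>

definition plane_radius :: "'n \<Rightarrow> 'n \<Rightarrow> real ^ 'n \<Rightarrow> real" where
  "plane_radius i j v = sqrt ((v $ i)\<^sup>2 + (v $ j)\<^sup>2)"

text \<open>In contrast to \<open>plane_rot\<close>, the angle here is absolute: the old polar angle
  of \<open>v\<close> is forgotten and only its radius survives. This makes \<phi> the true planar
  angle of the result, to be drawn independently of \<open>v\<close>.\<close>

definition plane_set :: "'n \<Rightarrow> 'n \<Rightarrow> real \<Rightarrow> real ^ 'n \<Rightarrow> real ^ 'n" where
  "plane_set i j \<phi> v = (\<chi> k. if k = i then plane_radius i j v * cos \<phi>
                       else if k = j then plane_radius i j v * sin \<phi> else v $ k)"

lemma continuous_on_plane_radius:
  assumes "continuous_on U g"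
  shows "continuous_on U (\<lambda>s. plane_radius i j (g s))"
  unfolding plane_radius_def using assms by (intro continuous_intros)

lemma plane_set_measurable [measurable]:
  "(\<lambda>p. plane_set i j (fst p) (snd p)) \<in> borel_measurable (borel \<Otimes>\<^sub>M borel)"
proof -
  have "continuous_on UNIV (\<lambda>p. plane_set i j (fst p) (snd p))"
    unfolding plane_set_def
  proof (rule continuous_on_vec_lambda)
    fix k show "continuous_on UNIV (\<lambda>p. if k = i then plane_radius i j (snd p) * cos (fst p)
        else if k = j then plane_radius i j (snd p) * sin (fst p) else snd p $ k)"
      by (cases "k = i"; cases "k = j") (auto intro!: continuous_intros continuous_on_plane_radius)
  qed
  then show ?thesis unfolding borel_prod by (rule borel_measurable_continuous_onI)
qed

lemma norm_plane_set [simp]: "i \<noteq> j \<Longrightarrow> norm (plane_set i j \<phi> v) = norm v"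
proof (rule norm_eq_if_plane_eq[of i j])
  assume "i \<noteq> j"
  then have "(plane_set i j \<phi> v $ i)\<^sup>2 + (plane_set i j \<phi> v $ j)\<^sup>2
      = (plane_radius i j v)\<^sup>2 * ((cos \<phi>)\<^sup>2 + (sin \<phi>)\<^sup>2)"
    unfolding distrib_left power_mult_distrib[symmetric] by (simp add: plane_set_def)
  then show "(plane_set i j \<phi> v $ i)\<^sup>2 + (plane_set i j \<phi> v $ j)\<^sup>2 = (v $ i)\<^sup>2 + (v $ j)\<^sup>2"
    by (simp add: plane_radius_def)
qed (auto simp: plane_set_def)

text \<open>Here \<open>a\<close> is the old polar angle, the argument of the complex number with
  parts \<open>v $ i\<close> and \<open>v $ j\<close>. A vanishing radius needs no separate case,
  since any argument then represents 0.\<close>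

lemma plane_set_eq_plane_rot:
  assumes "i \<noteq> j"
  obtains a where "\<And>\<phi>. plane_set i j \<phi> v = plane_rot i j (\<phi> - a) v"
proof -
  define z where "z = Complex (v $ i) (v $ j)"
  define a where "a = Arg z"
  have r: "cmod z = plane_radius i j v" by (simp add: z_def plane_radius_def cmod_def)
  have "z = rcis (cmod z) a" by (simp add: a_def rcis_cmod_Arg)
  then have "Re z = cmod z * cos a" "Im z = cmod z * sin a"
    by (metis Re_rcis, metis Im_rcis)
  then have i: "v $ i = plane_radius i j v * cos a" and j: "v $ j = plane_radius i j v * sin a"
    unfolding r by (simp_all add: z_def)
  have "plane_set i j \<phi> v = plane_rot i j (\<phi> - a) v" for \<phi>
  proof -
    have "cos (\<phi> - a) * v $ i - sin (\<phi> - a) * v $ j = plane_radius i j v * cos (\<phi> - a + a)"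
      unfolding cos_add by (subst i, subst j) (simp add: algebra_simps)
    moreover have "sin (\<phi> - a) * v $ i + cos (\<phi> - a) * v $ j = plane_radius i j v * sin (\<phi> - a + a)"
      unfolding sin_add by (subst i, subst j) (simp add: algebra_simps)
    ultimately show ?thesis by (simp add: plane_set_def plane_rot_def vec_eq_iff)
  qed
  then show ?thesis by (rule that)
qed

text \<open>The factor compensates the mass 2 \<pi> of \<open>angle_measure\<close>, which stays
  unnormalised to match the XY model; resampling then reproduces \<open>sphere_measure\<close>
  exactly.\<close>

abbreviation sphere_measure' :: "(real ^ 'n) measure" where
  "sphere_measure' \<equiv> scale_measure (ennreal (1 / (2*pi))) sphere_measure"

lemma finite_measure_sphere': "finite_measure (sphere_measure' :: (real ^ 'n) measure)"
proof -
  interpret finite_measure "sphere_measure :: (real ^ 'n) measure" by (rule finite_measure_sphere)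
  show ?thesis
    by (rule finite_measureI) (simp add: space_scale_measure ennreal_mult_eq_top_iff)
qed

lemma borel_measurable_sphere': "(\<lambda>v. v) \<in> borel_measurable (sphere_measure' :: (real ^ 'n) measure)"
  using borel_measurable_sphere by (simp cong: measurable_cong_sets)

text \<open>For fixed v the image point has the law of a uniformly rotated v. After exchanging the
  integrals each rotation preserves the sphere measure, and the angular integral contributes the 2
  \<pi> that the scaling cancels.\<close>

lemma distr_angle_sphere:
  fixes T :: "real \<times> (real ^ 'n) \<Rightarrow> real ^ 'n"
  assumes ij: "i \<noteq> j" and T [measurable]: "T \<in> borel_measurable (borel \<Otimes>\<^sub>M borel)"
    and norm_T: "\<And>\<phi> v. norm (T (\<phi>, v)) = norm v"
    and avg: "\<And>v X. X \<in> sets borel \<Longrightarrow> (\<integral>\<^sup>+ \<phi>. indicator X (T (\<phi>, v)) \<partial>angle_measure)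
        = (\<integral>\<^sup>+ \<phi>. indicator X (plane_rot i j \<phi> v) \<partial>angle_measure)"
  shows "T \<in> angle_measure \<Otimes>\<^sub>M sphere_measure' \<rightarrow>\<^sub>M sphere_measure"
    and "distr (angle_measure \<Otimes>\<^sub>M sphere_measure') sphere_measure T = sphere_measure"
proof -
  let ?A = angle_measure and ?S = "sphere_measure :: (real ^ 'n) measure" and ?S' = "sphere_measure' :: (real ^ 'n) measure"
  interpret A: finite_measure ?A by (rule finite_measure_angle)
  interpret S: finite_measure ?S by (rule finite_measure_sphere)
  interpret S': finite_measure ?S' by (rule finite_measure_sphere')
  interpret AS: pair_sigma_finite ?A ?S' ..
  interpret AS0: pair_sigma_finite ?A ?S ..
  have sub: "(\<lambda>p. p) \<in> ?A \<Otimes>\<^sub>M M \<rightarrow>\<^sub>M borel \<Otimes>\<^sub>M borel" if "(\<lambda>v. v) \<in> borel_measurable M" for M :: "(real ^ 'n) measure"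
  proof -
    note [measurable] = that borel_measurable_angle
    have "(\<lambda>p. (fst p, snd p)) \<in> ?A \<Otimes>\<^sub>M M \<rightarrow>\<^sub>M borel \<Otimes>\<^sub>M borel" by measurable
    then show ?thesis by simp
  qed
  have TB: "T \<in> borel_measurable (?A \<Otimes>\<^sub>M ?S')"
    using measurable_compose[OF sub[OF borel_measurable_sphere'] T] .
  show TS: "T \<in> ?A \<Otimes>\<^sub>M ?S' \<rightarrow>\<^sub>M ?S"
    using TB by (rule measurable_sphere_measureI)
      (auto simp: space_pair_measure space_scale_measure space_sphere_measure norm_T)
  show "distr (?A \<Otimes>\<^sub>M ?S') ?S T = ?S"
  proof (rule measure_eqI)
    fix X assume "X \<in> sets (distr (?A \<Otimes>\<^sub>M ?S') ?S T)"
    then have XS: "X \<in> sets ?S" by simp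
    then have X: "X \<in> sets borel" by (rule sphere_measure_setsD)
    have mR: "(\<lambda>p. indicator X (plane_rot i j (fst p) (snd p)) :: ennreal) \<in> borel_measurable (?A \<Otimes>\<^sub>M ?S)"
      using measurable_compose[OF measurable_compose[OF sub[OF borel_measurable_sphere] plane_rot_measurable] borel_measurable_indicator[OF X]] .
    have mT: "(\<lambda>p. indicator X (T p) :: ennreal) \<in> borel_measurable (?A \<Otimes>\<^sub>M ?S')"
      using measurable_compose[OF TB borel_measurable_indicator[OF X]] .
    have "emeasure (distr (?A \<Otimes>\<^sub>M ?S') ?S T) X = (\<integral>\<^sup>+ y. indicator X y \<partial>distr (?A \<Otimes>\<^sub>M ?S') ?S T)"
      using XS by simp
    also have "\<dots> = (\<integral>\<^sup>+ p. indicator X (T p) \<partial>(?A \<Otimes>\<^sub>M ?S'))"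
      by (rule nn_integral_distr[OF TS]) (use XS in auto)
    also have "\<dots> = (\<integral>\<^sup>+ v. \<integral>\<^sup>+ \<phi>. indicator X (T (\<phi>, v)) \<partial>?A \<partial>?S')"
      by (rule AS.nn_integral_snd[OF mT, symmetric])
    also have "\<dots> = (\<integral>\<^sup>+ v. \<integral>\<^sup>+ \<phi>. indicator X (plane_rot i j \<phi> v) \<partial>?A \<partial>?S')"
      by (simp add: avg X)
    also have "\<dots> = ennreal (1 / (2*pi)) * (\<integral>\<^sup>+ v. \<integral>\<^sup>+ \<phi>. indicator X (plane_rot i j \<phi> v) \<partial>?A \<partial>?S)"
      using A.borel_measurable_nn_integral_fst[OF measurable_pair_swap[OF mR]]
      by (intro nn_integral_scale_measure) (simp add: case_prod_beta)
    also have "(\<integral>\<^sup>+ v. \<integral>\<^sup>+ \<phi>. indicator X (plane_rot i j \<phi> v) \<partial>?A \<partial>?S)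
        = (\<integral>\<^sup>+ \<phi>. \<integral>\<^sup>+ v. indicator X (plane_rot i j \<phi> v) \<partial>?S \<partial>?A)"
      using AS0.Fubini[OF mR] by simp
    also have "\<dots> = (\<integral>\<^sup>+ \<phi>. emeasure ?S X \<partial>?A)"
      using nn_integral_sphere_plane_rot[OF borel_measurable_indicator[OF X] ij] XS by simp
    also have "\<dots> = emeasure ?S X * ennreal (2*pi)" by (simp add: emeasure_angle_measure)
    also have "ennreal (1 / (2*pi)) * \<dots> = emeasure ?S X"
    proof -
      have "ennreal (1 / (2*pi)) * ennreal (2*pi) = 1" by (subst ennreal_mult[symmetric]) auto
      then show ?thesis by (metis mult.assoc mult.commute mult.right_neutral)
    qed
    finally show "emeasure (distr (?A \<Otimes>\<^sub>M ?S') ?S T) X = emeasure ?S X" .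
  qed simp
qed

text \<open>Given v, overwriting the angle by \<phi> + s is rotating by \<phi> + (s - a) with a
  fixed; shift invariance of the uniform angle removes s - a.\<close>

lemma distr_plane_set:
  fixes i j :: "'n::finite"
  assumes ij: "i \<noteq> j"
  shows "(\<lambda>p. plane_set i j (fst p + s) (snd p)) \<in> angle_measure \<Otimes>\<^sub>M sphere_measure' \<rightarrow>\<^sub>M sphere_measure"
    and "distr (angle_measure \<Otimes>\<^sub>M sphere_measure') sphere_measure (\<lambda>p. plane_set i j (fst p + s) (snd p)) = sphere_measure"
proof -
  have avg: "(\<integral>\<^sup>+ \<phi>. indicator X (plane_set i j (\<phi> + s) v) \<partial>angle_measure)
        = (\<integral>\<^sup>+ \<phi>. indicator X (plane_rot i j \<phi> v) \<partial>angle_measure)" if X [measurable]: "X \<in> sets borel" for X and v :: "real ^ 'n"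
  proof -
    obtain a where a: "\<And>\<phi>. plane_set i j \<phi> v = plane_rot i j (\<phi> - a) v" using plane_set_eq_plane_rot[OF ij] by blast
    have [measurable]: "(\<lambda>\<phi>. plane_rot i j \<phi> v) \<in> borel_measurable borel"
      by (intro borel_measurable_continuous_onI continuous_on_plane_rot continuous_intros)
    have "\<phi> + s - a = \<phi> + (s - a)" for \<phi> by simp
    then show ?thesis
      unfolding a using nn_integral_angle_shift[of "\<lambda>\<phi>. indicator X (plane_rot i j \<phi> v)" "s - a"]
      by (simp only: plane_rot_periodic) measurable
  qed
  have "(\<lambda>p :: real \<times> (real ^ 'n). (fst p + s, snd p)) \<in> borel \<Otimes>\<^sub>M borel \<rightarrow>\<^sub>M borel \<Otimes>\<^sub>M borel"
    by measurable
  from measurable_compose[OF this plane_set_measurable[of i j]]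
  have "(\<lambda>p. plane_set i j (fst p + s) (snd p)) \<in> borel_measurable (borel \<Otimes>\<^sub>M borel)" by simp
  from distr_angle_sphere[OF ij this]
  show "(\<lambda>p. plane_set i j (fst p + s) (snd p)) \<in> angle_measure \<Otimes>\<^sub>M sphere_measure' \<rightarrow>\<^sub>M sphere_measure"
    and "distr (angle_measure \<Otimes>\<^sub>M sphere_measure') sphere_measure (\<lambda>p. plane_set i j (fst p + s) (snd p)) = sphere_measure"
    using norm_plane_set[OF ij] avg by simp_all
qed

section \<open>Observables of the N-vector model\<close>

abbreviation sphere_PiM :: "'a set \<Rightarrow> ('a \<Rightarrow> real ^ 'n) measure" where
  "sphere_PiM \<Lambda> \<equiv> PiM \<Lambda> (\<lambda>_. sphere_measure)"

abbreviation sphere_PiM' :: "'a set \<Rightarrow> ('a \<Rightarrow> real ^ 'n) measure" where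
  "sphere_PiM' \<Lambda> \<equiv> PiM \<Lambda> (\<lambda>_. sphere_measure')"

definition NV_weight :: "'a set \<Rightarrow> ('a \<Rightarrow> 'a \<Rightarrow> real) \<Rightarrow> ('a \<Rightarrow> real ^ 'n) \<Rightarrow> real" where
  "NV_weight \<Lambda> K \<sigma> = exp (pair_sum \<Lambda> (\<lambda>u v. K u v * (\<sigma> u \<bullet> \<sigma> v)))"

lemma sphere_component_measurable [measurable]:
  assumes "u \<in> \<Lambda>"
  shows "(\<lambda>\<sigma>. \<sigma> u) \<in> borel_measurable (sphere_PiM \<Lambda> :: ('a \<Rightarrow> real ^ 'n) measure)"
  using borel_measurable_sphere by (rule measurable_compose[OF measurable_component_singleton[OF assms]])

lemma norm_sphere_PiM: "\<sigma> \<in> space (sphere_PiM \<Lambda>) \<Longrightarrow> u \<in> \<Lambda> \<Longrightarrow> norm (\<sigma> u :: real ^ 'n) = 1"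
  by (auto simp: space_PiM space_sphere_measure)

text \<open>The bound is asked only on the product of spheres: spin components and radii are
  unbounded elsewhere.\<close>

definition bounded_obs :: "'a set \<Rightarrow> (('a \<Rightarrow> real ^ 'n) \<Rightarrow> real) \<Rightarrow> bool" where
  "bounded_obs \<Lambda> f \<longleftrightarrow> f \<in> borel_measurable (sphere_PiM \<Lambda>) \<and> (\<exists>B. \<forall>\<sigma>\<in>space (sphere_PiM \<Lambda>). \<bar>f \<sigma>\<bar> \<le> B)"

lemma bounded_obsI:
  assumes "f \<in> borel_measurable (sphere_PiM \<Lambda>)" "\<And>\<sigma>. \<sigma> \<in> space (sphere_PiM \<Lambda>) \<Longrightarrow> \<bar>f \<sigma>\<bar> \<le> B"
  shows "bounded_obs \<Lambda> f"
  using assms unfolding bounded_obs_def by blast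

lemma bounded_obsE:
  assumes "bounded_obs \<Lambda> f"
  obtains B where "f \<in> borel_measurable (sphere_PiM \<Lambda>)" "\<forall>\<sigma>\<in>space (sphere_PiM \<Lambda>). \<bar>f \<sigma>\<bar> \<le> B"
  using assms unfolding bounded_obs_def by (elim conjE exE)

lemma bounded_obs_const: "bounded_obs \<Lambda> (\<lambda>_. c)"
  by (rule bounded_obsI[where B="\<bar>c\<bar>"]) auto

lemma bounded_obs_add:
  assumes f: "bounded_obs \<Lambda> f" and g: "bounded_obs \<Lambda> g"
  shows "bounded_obs \<Lambda> (\<lambda>\<sigma>. f \<sigma> + g \<sigma>)"
proof -
  obtain B where B: "f \<in> borel_measurable (sphere_PiM \<Lambda>)" "\<forall>\<sigma>\<in>space (sphere_PiM \<Lambda>). \<bar>f \<sigma>\<bar> \<le> B"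
    using f by (rule bounded_obsE)
  obtain C where C: "g \<in> borel_measurable (sphere_PiM \<Lambda>)" "\<forall>\<sigma>\<in>space (sphere_PiM \<Lambda>). \<bar>g \<sigma>\<bar> \<le> C"
    using g by (rule bounded_obsE)
  show ?thesis
    by (intro bounded_obsI[where B="B + C"] borel_measurable_add B(1) C(1)
        order_trans[OF abs_triangle_ineq] add_mono B(2)[rule_format] C(2)[rule_format])
qed

lemma bounded_obs_mult:
  assumes f: "bounded_obs \<Lambda> f" and g: "bounded_obs \<Lambda> g"
  shows "bounded_obs \<Lambda> (\<lambda>\<sigma>. f \<sigma> * g \<sigma>)"
proof -
  obtain B where B: "f \<in> borel_measurable (sphere_PiM \<Lambda>)" "\<forall>\<sigma>\<in>space (sphere_PiM \<Lambda>). \<bar>f \<sigma>\<bar> \<le> B"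
    using f by (rule bounded_obsE)
  obtain C where C: "g \<in> borel_measurable (sphere_PiM \<Lambda>)" "\<forall>\<sigma>\<in>space (sphere_PiM \<Lambda>). \<bar>g \<sigma>\<bar> \<le> C"
    using g by (rule bounded_obsE)
  show ?thesis
  proof (rule bounded_obsI)
    show "\<bar>f \<sigma> * g \<sigma>\<bar> \<le> B * C" if "\<sigma> \<in> space (sphere_PiM \<Lambda>)" for \<sigma>
      unfolding abs_mult using B(2)[rule_format, OF that] C(2)[rule_format, OF that] by (intro mult_mono) auto
  qed (intro borel_measurable_times B(1) C(1))
qed

lemma bounded_obs_diff:
  assumes "bounded_obs \<Lambda> f" "bounded_obs \<Lambda> g"
  shows "bounded_obs \<Lambda> (\<lambda>\<sigma>. f \<sigma> - g \<sigma>)"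
  using bounded_obs_add[OF assms(1) bounded_obs_mult[OF bounded_obs_const[of \<Lambda> "-1"] assms(2)]] by simp

lemma bounded_obs_power:
  assumes "bounded_obs \<Lambda> f"
  shows "bounded_obs \<Lambda> (\<lambda>\<sigma>. f \<sigma> ^ n)"
  by (induction n) (auto intro: bounded_obs_const bounded_obs_mult assms)

lemma bounded_obs_component:
  assumes u: "u \<in> \<Lambda>"
  shows "bounded_obs \<Lambda> (\<lambda>\<sigma>. (\<sigma> u :: real ^ 'n) $ k)"
proof -
  have "(\<lambda>v :: real ^ 'n. v $ k) \<in> borel_measurable borel"
    by (intro borel_measurable_continuous_onI continuous_intros)
  then have "(\<lambda>\<sigma>. (\<sigma> u :: real ^ 'n) $ k) \<in> borel_measurable (sphere_PiM \<Lambda>)"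
    by (rule measurable_compose[OF sphere_component_measurable[OF u]])
  then show ?thesis
  proof (rule bounded_obsI)
    show "\<bar>(\<sigma> u :: real ^ 'n) $ k\<bar> \<le> 1" if "\<sigma> \<in> space (sphere_PiM \<Lambda>)" for \<sigma>
      using component_le_norm_cart[of "\<sigma> u" k] norm_sphere_PiM[OF that u] by simp
  qed
qed

lemma bounded_obs_plane_radius:
  assumes u: "u \<in> \<Lambda>"
  shows "bounded_obs \<Lambda> (\<lambda>\<sigma>. plane_radius i j (\<sigma> u :: real ^ 'n))"
proof -
  have obs: "bounded_obs \<Lambda> (\<lambda>\<sigma>. (\<sigma> u $ i)\<^sup>2 + (\<sigma> u $ j)\<^sup>2 :: real)"
    by (intro bounded_obs_add bounded_obs_power bounded_obs_component u)
  then obtain B where B: "(\<lambda>\<sigma>. (\<sigma> u $ i)\<^sup>2 + (\<sigma> u $ j)\<^sup>2 :: real) \<in> borel_measurable (sphere_PiM \<Lambda>)"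
    "\<forall>\<sigma>\<in>space (sphere_PiM \<Lambda>). \<bar>(\<sigma> u $ i)\<^sup>2 + (\<sigma> u $ j)\<^sup>2\<bar> \<le> B"
    by (rule bounded_obsE)
  show ?thesis
  proof (rule bounded_obsI)
    show "(\<lambda>\<sigma>. plane_radius i j (\<sigma> u :: real ^ 'n)) \<in> borel_measurable (sphere_PiM \<Lambda>)"
      unfolding plane_radius_def by (rule measurable_compose[OF B(1) borel_measurable_sqrt])
    show "\<bar>plane_radius i j (\<sigma> u)\<bar> \<le> sqrt B" if "\<sigma> \<in> space (sphere_PiM \<Lambda>)" for \<sigma>
      using B(2)[rule_format, OF that] by (simp add: plane_radius_def)
  qed
qed

lemma bounded_obs_NV_weight: "bounded_obs \<Lambda> (NV_weight \<Lambda> K :: ('a \<Rightarrow> real ^ 'n) \<Rightarrow> real)"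
proof -
  have "NV_weight \<Lambda> K \<in> borel_measurable (sphere_PiM \<Lambda> :: ('a \<Rightarrow> real ^ 'n) measure)"
    unfolding NV_weight_def[abs_def] by (intro borel_measurable_exp_pair_sum) measurable
  moreover have "\<bar>NV_weight \<Lambda> K \<sigma>\<bar> \<le> exp (pair_sum \<Lambda> (\<lambda>u v. \<bar>K u v\<bar>))" if s: "\<sigma> \<in> space (sphere_PiM \<Lambda>)" for \<sigma> :: "'a \<Rightarrow> real ^ 'n"
  proof -
    have "pair_sum \<Lambda> (\<lambda>u v. K u v * (\<sigma> u \<bullet> \<sigma> v)) \<le> pair_sum \<Lambda> (\<lambda>u v. \<bar>K u v\<bar>)"
      unfolding pair_sum_def
    proof (intro mult_left_mono sum_mono)
      fix u v assume "u \<in> \<Lambda>" "v \<in> \<Lambda> - {u}"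
      then have "\<bar>\<sigma> u \<bullet> \<sigma> v\<bar> \<le> 1" using Cauchy_Schwarz_ineq2[of "\<sigma> u" "\<sigma> v"] s by (simp add: norm_sphere_PiM)
      then have "\<bar>K u v\<bar> * \<bar>\<sigma> u \<bullet> \<sigma> v\<bar> \<le> \<bar>K u v\<bar> * 1" by (intro mult_left_mono) auto
      then show "K u v * (\<sigma> u \<bullet> \<sigma> v) \<le> \<bar>K u v\<bar>" by (simp add: abs_mult[symmetric])
    qed simp
    then show ?thesis by (simp add: NV_weight_def)
  qed
  ultimately show ?thesis by (rule bounded_obsI)
qed

lemma bounded_obs_integrable:
  assumes \<Lambda>: "finite \<Lambda>" and f: "bounded_obs \<Lambda> (f :: ('a \<Rightarrow> real ^ 'n) \<Rightarrow> real)"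
  shows "integrable (sphere_PiM \<Lambda>) f"
proof -
  interpret finite_measure "sphere_PiM \<Lambda> :: ('a \<Rightarrow> real ^ 'n) measure"
    by (intro finite_measure_PiM \<Lambda> finite_measure_sphere)
  obtain B where B: "f \<in> borel_measurable (sphere_PiM \<Lambda>)" "\<forall>\<sigma>\<in>space (sphere_PiM \<Lambda>). \<bar>f \<sigma>\<bar> \<le> B"
    using f by (rule bounded_obsE)
  show ?thesis
    by (intro integrable_const_bound[where B=B] AE_I2) (simp_all add: B)
qed

lemma integrable_NV_weight_mult:
  assumes "finite \<Lambda>" "bounded_obs \<Lambda> (f :: ('a \<Rightarrow> real ^ 'n) \<Rightarrow> real)"
  shows "integrable (sphere_PiM \<Lambda>) (\<lambda>\<sigma>. f \<sigma> * NV_weight \<Lambda> K \<sigma>)"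
  by (intro bounded_obs_integrable bounded_obs_mult bounded_obs_NV_weight assms)

text \<open>Unnormalised expectation. All comparisons are linear in it, so the partition function is
  just its value at 1 and is divided out last.\<close>

definition NV_integral :: "'a set \<Rightarrow> ('a \<Rightarrow> 'a \<Rightarrow> real) \<Rightarrow> (('a \<Rightarrow> real ^ 'n) \<Rightarrow> real) \<Rightarrow> real" where
  "NV_integral \<Lambda> K f = (\<integral>\<sigma>. f \<sigma> * NV_weight \<Lambda> K \<sigma> \<partial>sphere_PiM \<Lambda>)"

lemma NV_integral_add:
  assumes "finite \<Lambda>" "bounded_obs \<Lambda> f" "bounded_obs \<Lambda> g"
  shows "NV_integral \<Lambda> K (\<lambda>\<sigma>. f \<sigma> + g \<sigma>) = NV_integral \<Lambda> K f + NV_integral \<Lambda> K g"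
  using integrable_NV_weight_mult[OF assms(1,2), of K] integrable_NV_weight_mult[OF assms(1,3), of K]
  by (simp add: NV_integral_def distrib_right)

lemma NV_integral_diff:
  assumes "finite \<Lambda>" "bounded_obs \<Lambda> f" "bounded_obs \<Lambda> g"
  shows "NV_integral \<Lambda> K (\<lambda>\<sigma>. f \<sigma> - g \<sigma>) = NV_integral \<Lambda> K f - NV_integral \<Lambda> K g"
  using integrable_NV_weight_mult[OF assms(1,2), of K] integrable_NV_weight_mult[OF assms(1,3), of K]
  by (simp add: NV_integral_def left_diff_distrib)

lemma NV_integral_cmult: "NV_integral \<Lambda> K (\<lambda>\<sigma>. c * f \<sigma>) = c * NV_integral \<Lambda> K f"
  by (simp add: NV_integral_def mult.assoc)

lemma NV_integral_sum:
  assumes "finite \<Lambda>" "\<And>k. k \<in> I \<Longrightarrow> bounded_obs \<Lambda> (f k)"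
  shows "NV_integral \<Lambda> K (\<lambda>\<sigma>. \<Sum>k\<in>I. f k \<sigma>) = (\<Sum>k\<in>I. NV_integral \<Lambda> K (f k))"
  unfolding NV_integral_def sum_distrib_right
  by (rule Bochner_Integration.integral_sum) (rule integrable_NV_weight_mult[OF assms])

lemma NV_integral_mono:
  assumes "finite \<Lambda>" "bounded_obs \<Lambda> f" "bounded_obs \<Lambda> g"
    and "\<And>\<sigma>. \<sigma> \<in> space (sphere_PiM \<Lambda>) \<Longrightarrow> f \<sigma> \<le> g \<sigma>"
  shows "NV_integral \<Lambda> K f \<le> NV_integral \<Lambda> K g"
  unfolding NV_integral_def
  by (intro integral_mono integrable_NV_weight_mult assms mult_right_mono) (auto simp: NV_weight_def)

lemma NV_integral_cong:
  assumes "\<And>\<sigma>. \<sigma> \<in> space (sphere_PiM \<Lambda>) \<Longrightarrow> f \<sigma> = g \<sigma>"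
  shows "NV_integral \<Lambda> K f = NV_integral \<Lambda> K g"
  unfolding NV_integral_def using assms by (intro Bochner_Integration.integral_cong) auto

lemma NV_integral_one_pos:
  assumes "finite \<Lambda>"
  shows "0 < NV_integral \<Lambda> K (\<lambda>_ :: 'a \<Rightarrow> real ^ 'n. 1)"
  unfolding NV_integral_def
  by (intro integral_pos integrable_NV_weight_mult bounded_obs_const emeasure_PiM_space_neq_0
       finite_measure_sphere emeasure_sphere_measure_neq_0 assms) (simp add: NV_weight_def)

lemma NV_expect_eq:
  "NV_expect \<Lambda> K (f :: ('a \<Rightarrow> real ^ 'n) \<Rightarrow> real) = NV_integral \<Lambda> K f / NV_integral \<Lambda> K (\<lambda>_ :: 'a \<Rightarrow> real ^ 'n. 1)"
  by (simp add: NV_expect_def NV_integral_def NV_weight_def Let_def)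

section \<open>Conditioning on the radii in a plane\<close>

text \<open>The offset \<open>s\<close>, common to all sites, produces the simultaneous rotation by
  \<pi>/4; the XY comparison takes it to be 0.\<close>

definition set_planes :: "'a set \<Rightarrow> 'n \<Rightarrow> 'n \<Rightarrow> real \<Rightarrow> ('a \<Rightarrow> real) \<times> ('a \<Rightarrow> real ^ 'n) \<Rightarrow> 'a \<Rightarrow> real ^ 'n" where
  "set_planes \<Lambda> i j s p = (\<lambda>u\<in>\<Lambda>. plane_set i j (fst p u + s) (snd p u))"

text \<open>Stands in for polar coordinates: integrals over all spins become integrals over fresh
  angles and old spins, of which only the radii and the components outside the plane are
  read.\<close>

lemma set_planes_transfer:
  fixes F :: "('a \<Rightarrow> real ^ 'n) \<Rightarrow> real" and i j :: "'n::finite"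
  assumes \<Lambda>: "finite \<Lambda>" and ij: "i \<noteq> j" and F: "bounded_obs \<Lambda> F"
  shows "integrable (angle_PiM \<Lambda> \<Otimes>\<^sub>M sphere_PiM' \<Lambda>) (\<lambda>p. F (set_planes \<Lambda> i j s p))"
    and "(\<integral>p. F (set_planes \<Lambda> i j s p) \<partial>(angle_PiM \<Lambda> \<Otimes>\<^sub>M sphere_PiM' \<Lambda>)) = integral\<^sup>L (sphere_PiM \<Lambda>) F"
proof -
  let ?M = "angle_PiM \<Lambda> \<Otimes>\<^sub>M (sphere_PiM' \<Lambda> :: ('a \<Rightarrow> real ^ 'n) measure)"
  let ?T = "\<lambda>p. plane_set i j (fst p + s) (snd p :: real ^ 'n)"
  have fin: "finite_measure angle_measure" "finite_measure (sphere_measure' :: (real ^ 'n) measure)"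
    "finite_measure (sphere_measure :: (real ^ 'n) measure)"
    by (fact finite_measure_angle finite_measure_sphere' finite_measure_sphere)+
  then have sf: "sigma_finite_measure angle_measure" "sigma_finite_measure (sphere_measure' :: (real ^ 'n) measure)"
    "sigma_finite_measure (sphere_measure :: (real ^ 'n) measure)"
    by (simp_all add: finite_measure_def)
  note T [measurable] = distr_plane_set(1)[OF ij, of s]
  have S: "set_planes \<Lambda> i j s \<in> ?M \<rightarrow>\<^sub>M sphere_PiM \<Lambda>"
  proof -
    have "(\<lambda>p. \<lambda>u\<in>\<Lambda>. ?T (fst p u, snd p u)) \<in> ?M \<rightarrow>\<^sub>M sphere_PiM \<Lambda>"
      by measurable
    then show ?thesis by (simp add: set_planes_def[abs_def])
  qed
  have "distr ?M (sphere_PiM \<Lambda>) (\<lambda>p. \<lambda>u\<in>\<Lambda>. ?T (fst p u, snd p u)) = sphere_PiM \<Lambda>"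
    by (rule PiM_distr_pair[OF \<Lambda> sf T distr_plane_set(2)[OF ij]])
  then have D: "distr ?M (sphere_PiM \<Lambda>) (set_planes \<Lambda> i j s) = sphere_PiM \<Lambda>"
    by (simp add: set_planes_def[abs_def])
  have "integrable (distr ?M (sphere_PiM \<Lambda>) (set_planes \<Lambda> i j s)) F"
    unfolding D by (rule bounded_obs_integrable[OF \<Lambda> F])
  then show "integrable ?M (\<lambda>p. F (set_planes \<Lambda> i j s p))"
    by (rule integrable_distr[OF S])
  have "integral\<^sup>L (distr ?M (sphere_PiM \<Lambda>) (set_planes \<Lambda> i j s)) F = (\<integral>p. F (set_planes \<Lambda> i j s p) \<partial>?M)"
    by (rule integral_distr[OF S]) (rule bounded_obsE[OF F])
  then show "(\<integral>p. F (set_planes \<Lambda> i j s p) \<partial>?M) = integral\<^sup>L (sphere_PiM \<Lambda>) F"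
    unfolding D by simp
qed

lemma plane_set_inner:
  fixes v w :: "real ^ 'n"
  assumes "i \<noteq> j"
  shows "plane_set i j \<phi> v \<bullet> plane_set i j \<psi> w
    = (\<Sum>k\<in>UNIV - {i, j}. v $ k * w $ k) + plane_radius i j v * plane_radius i j w * cos (\<phi> - \<psi>)"
proof -
  have "plane_set i j \<phi> v \<bullet> plane_set i j \<psi> w
    = plane_radius i j v * cos \<phi> * (plane_radius i j w * cos \<psi>)
      + plane_radius i j v * sin \<phi> * (plane_radius i j w * sin \<psi>)
      + (\<Sum>k\<in>UNIV - {i, j}. plane_set i j \<phi> v $ k * plane_set i j \<psi> w $ k)"
    unfolding inner_vec_def sum_plane_split[OF assms] using assms by (simp add: plane_set_def)
  also have "(\<Sum>k\<in>UNIV - {i, j}. plane_set i j \<phi> v $ k * plane_set i j \<psi> w $ k) = (\<Sum>k\<in>UNIV - {i, j}. v $ k * w $ k)"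
    by (intro sum.cong) (auto simp: plane_set_def)
  finally show ?thesis by (simp add: cos_diff algebra_simps)
qed

text \<open>The weight sees planar angles only through differences, so \<open>s\<close> cancels.
  This gives both the conditional XY model and the invariance of the weight under a common
  rotation.\<close>

lemma NV_weight_set_planes:
  fixes i j :: "'n::finite"
  assumes ij: "i \<noteq> j"
  shows "NV_weight \<Lambda> K (set_planes \<Lambda> i j s (\<phi>, \<sigma>))
    = exp (pair_sum \<Lambda> (\<lambda>u v. K u v * (\<Sum>k\<in>UNIV - {i, j}. \<sigma> u $ k * \<sigma> v $ k)))
      * XY_weight \<Lambda> (\<lambda>u v. K u v * (plane_radius i j (\<sigma> u) * plane_radius i j (\<sigma> v))) \<phi>"
proof -
  have "pair_sum \<Lambda> (\<lambda>u v. K u v * (set_planes \<Lambda> i j s (\<phi>, \<sigma>) u \<bullet> set_planes \<Lambda> i j s (\<phi>, \<sigma>) v))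
    = pair_sum \<Lambda> (\<lambda>u v. K u v * (\<Sum>k\<in>UNIV - {i, j}. \<sigma> u $ k * \<sigma> v $ k)
       + K u v * (plane_radius i j (\<sigma> u) * plane_radius i j (\<sigma> v)) * cos (\<phi> u - \<phi> v))"
    by (rule pair_sum_cong) (simp add: set_planes_def plane_set_inner[OF ij] algebra_simps)
  then show ?thesis
    unfolding NV_weight_def XY_weight_def exp_add[symmetric] pair_sum_add[symmetric] by simp
qed

lemma plane_radius_le_1:
  assumes "i \<noteq> j" "norm (v :: real ^ 'n) = 1"
  shows "0 \<le> plane_radius i j v" "plane_radius i j v \<le> 1"
proof -
  have "(\<Sum>k\<in>UNIV. (v $ k)\<^sup>2) = 1" using assms(2) by (simp add: norm_vec_def L2_set_def)
  then have "(v $ i)\<^sup>2 + (v $ j)\<^sup>2 \<le> 1"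
    using sum_nonneg[of "UNIV - {i, j}" "\<lambda>k. (v $ k)\<^sup>2"] by (simp add: sum_plane_split[OF assms(1)])
  then show "plane_radius i j v \<le> 1" by (simp add: plane_radius_def)
qed (simp add: plane_radius_def)

section \<open>XY correlations and the conditional comparison\<close>

definition XY_corr :: "'a set \<Rightarrow> ('a \<Rightarrow> 'a \<Rightarrow> real) \<Rightarrow> nat \<Rightarrow> 'a \<Rightarrow> 'a \<Rightarrow> real" where
  "XY_corr \<Lambda> K m x y = XY_expect \<Lambda> K (\<lambda>\<theta>. cos (real m * (\<theta> x - \<theta> y)))"

lemma XY_weight_integrable:
  assumes "finite \<Lambda>"
  shows "integrable (angle_PiM \<Lambda>) (XY_weight \<Lambda> K)"
  by (rule finite_measure.integrable_const_bound[OF finite_measure_PiM[OF assms finite_measure_angle] _ XY_weight_measurable])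
     (unfold real_norm_def, rule AE_I2, rule XY_weight_bounded)

lemma XY_obs_integrable:
  assumes "finite \<Lambda>" "x \<in> \<Lambda>" "y \<in> \<Lambda>"
  shows "integrable (angle_PiM \<Lambda>) (\<lambda>\<theta>. cos (real m * (\<theta> x - \<theta> y)) * XY_weight \<Lambda> K \<theta>)"
  by (rule finite_measure.integrable_const_bound[OF finite_measure_PiM[OF assms(1) finite_measure_angle] _ XY_obs_measurable[OF assms(2,3)]])
     (unfold real_norm_def, rule AE_I2, rule XY_obs_bounded)

lemma XY_partition_pos:
  assumes "finite \<Lambda>"
  shows "0 < integral\<^sup>L (angle_PiM \<Lambda>) (XY_weight \<Lambda> K)"
proof (rule integral_pos)
  show "integrable (angle_PiM \<Lambda>) (XY_weight \<Lambda> K)" by (rule XY_weight_integrable[OF assms])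
  show "emeasure (angle_PiM \<Lambda>) (space (angle_PiM \<Lambda>)) \<noteq> 0"
    by (intro emeasure_PiM_space_neq_0 assms finite_measure_angle) (simp add: emeasure_angle_measure)
qed (simp add: XY_weight_def)

lemma XY_corr_eq:
  "XY_corr \<Lambda> K m x y = (\<integral>\<theta>. cos (real m * (\<theta> x - \<theta> y)) * XY_weight \<Lambda> K \<theta> \<partial>angle_PiM \<Lambda>)
     / integral\<^sup>L (angle_PiM \<Lambda>) (XY_weight \<Lambda> K)"
  by (simp add: XY_corr_def XY_expect_def XY_weight_def[abs_def] Let_def)

text \<open>Only the J side is normalised: the K side will depend on frozen radii and has to be
  integrated further, where its partition function reassembles into an N-vector integral.\<close>

lemma XY_ginibre_corr:
  assumes "finite \<Lambda>" "x \<in> \<Lambda>" "y \<in> \<Lambda>"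
    and "\<And>u v. u \<in> \<Lambda> \<Longrightarrow> v \<in> \<Lambda> \<Longrightarrow> u \<noteq> v \<Longrightarrow> \<bar>K u v\<bar> \<le> J u v"
  shows "\<bar>\<integral>\<theta>. cos (real m * (\<theta> x - \<theta> y)) * XY_weight \<Lambda> K \<theta> \<partial>angle_PiM \<Lambda>\<bar>
    \<le> XY_corr \<Lambda> J m x y * integral\<^sup>L (angle_PiM \<Lambda>) (XY_weight \<Lambda> K)"
  using XY_ginibre[OF assms, where m=m] XY_partition_pos[OF assms(1), of J]
  unfolding XY_corr_eq by (simp add: field_simps)

text \<open>Ginibre's inequality with K = J bounds an absolute value by the correlation times a
  positive partition function.\<close>

lemma XY_corr_nonneg:
  assumes "finite \<Lambda>" "x \<in> \<Lambda>" "y \<in> \<Lambda>"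
    and "\<And>u v. u \<in> \<Lambda> \<Longrightarrow> v \<in> \<Lambda> \<Longrightarrow> u \<noteq> v \<Longrightarrow> 0 \<le> J u v"
  shows "0 \<le> XY_corr \<Lambda> J m x y"
proof -
  have "0 \<le> XY_corr \<Lambda> J m x y * integral\<^sup>L (angle_PiM \<Lambda>) (XY_weight \<Lambda> J)"
    by (rule order_trans[OF abs_ge_zero XY_ginibre_corr[OF assms(1-3)]]) (simp add: assms(4))
  then show ?thesis using XY_partition_pos[OF assms(1), of J] by (simp add: zero_le_mult_iff)
qed

lemma XY_corr_le_1:
  assumes "finite \<Lambda>" "x \<in> \<Lambda>" "y \<in> \<Lambda>"
  shows "XY_corr \<Lambda> J m x y \<le> 1"
proof -
  have "(\<integral>\<theta>. cos (real m * (\<theta> x - \<theta> y)) * XY_weight \<Lambda> J \<theta> \<partial>angle_PiM \<Lambda>) \<le> integral\<^sup>L (angle_PiM \<Lambda>) (XY_weight \<Lambda> J)"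
  proof (rule integral_mono[OF XY_obs_integrable[OF assms] XY_weight_integrable[OF assms(1)]])
    fix \<theta>
    have "cos (real m * (\<theta> x - \<theta> y)) * XY_weight \<Lambda> J \<theta> \<le> 1 * XY_weight \<Lambda> J \<theta>"
      by (intro mult_right_mono) (simp_all add: XY_weight_def)
    then show "cos (real m * (\<theta> x - \<theta> y)) * XY_weight \<Lambda> J \<theta> \<le> XY_weight \<Lambda> J \<theta>" by simp
  qed
  then show ?thesis using XY_partition_pos[OF assms(1), of J] by (simp add: XY_corr_eq)
qed

text \<open>Conditionally on the radii in the plane \<open>(i, j)\<close> and on the other components, the angles form an
  XY model with couplings \<open>J'\<^sub>u\<^sub>v r\<^sub>u r\<^sub>v\<close>, whose modulus is at most \<open>J\<^sub>u\<^sub>v\<close> since radii are at most 1.\<close>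
lemma NV_plane_comparison:
  fixes G :: "('a \<Rightarrow> real ^ 'n) \<Rightarrow> real" and i j :: "'n::finite"
  assumes \<Lambda>: "finite \<Lambda>" and x: "x \<in> \<Lambda>" and y: "y \<in> \<Lambda>" and ij: "i \<noteq> j"
    and J: "\<And>u v. u \<in> \<Lambda> \<Longrightarrow> v \<in> \<Lambda> \<Longrightarrow> u \<noteq> v \<Longrightarrow> \<bar>J' u v\<bar> \<le> J u v"
    and G: "bounded_obs \<Lambda> G"
    and G_eq: "\<And>\<phi> \<sigma>. G (set_planes \<Lambda> i j 0 (\<phi>, \<sigma>))
      = (plane_radius i j (\<sigma> x) * plane_radius i j (\<sigma> y)) ^ m * cos (real m * (\<phi> x - \<phi> y))"
  shows "\<bar>NV_integral \<Lambda> J' G\<bar>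
    \<le> XY_corr \<Lambda> J m x y * NV_integral \<Lambda> J' (\<lambda>\<sigma>. (plane_radius i j (\<sigma> x) * plane_radius i j (\<sigma> y)) ^ m)"
proof -
  let ?A = "angle_PiM \<Lambda>" and ?S' = "sphere_PiM' \<Lambda> :: ('a \<Rightarrow> real ^ 'n) measure"
  let ?r = "\<lambda>\<sigma>. (plane_radius i j (\<sigma> x :: real ^ 'n) * plane_radius i j (\<sigma> y :: real ^ 'n)) ^ m"
  let ?T = "\<lambda>\<phi> \<sigma>. set_planes \<Lambda> i j 0 (\<phi>, \<sigma> :: 'a \<Rightarrow> real ^ 'n)"
  let ?w = "NV_weight \<Lambda> J' :: ('a \<Rightarrow> real ^ 'n) \<Rightarrow> real"
  interpret A: finite_measure ?A by (intro finite_measure_PiM \<Lambda> finite_measure_angle)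
  interpret S': finite_measure ?S' by (intro finite_measure_PiM \<Lambda> finite_measure_sphere')
  interpret AS: pair_sigma_finite ?A ?S' ..
  define e where "e \<sigma> = exp (pair_sum \<Lambda> (\<lambda>u v. J' u v * (\<Sum>k\<in>UNIV - {i, j}. \<sigma> u $ k * \<sigma> v $ k)))"
    for \<sigma> :: "'a \<Rightarrow> real ^ 'n"
  define K where "K \<sigma> = (\<lambda>u v. J' u v * (plane_radius i j (\<sigma> u) * plane_radius i j (\<sigma> v)))"
    for \<sigma> :: "'a \<Rightarrow> real ^ 'n"
  have w: "?w (?T \<phi> \<sigma>) = e \<sigma> * XY_weight \<Lambda> (K \<sigma>) \<phi>" for \<phi> \<sigma>
    unfolding e_def K_def by (rule NV_weight_set_planes[OF ij])
  have r: "?r (?T \<phi> \<sigma>) = ?r \<sigma>" for \<phi> \<sigma>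
  proof -
    have "plane_radius i j (plane_set i j \<alpha> v) = plane_radius i j v" for \<alpha> and v :: "real ^ 'n"
    proof -
      have "(plane_radius i j v * cos \<alpha>)\<^sup>2 + (plane_radius i j v * sin \<alpha>)\<^sup>2 = (plane_radius i j v)\<^sup>2"
        unfolding power_mult_distrib distrib_left[symmetric] by simp
      then show ?thesis
        using ij unfolding plane_radius_def[of i j "plane_set i j \<alpha> v"]
        by (simp add: plane_set_def) (simp add: plane_radius_def)
    qed
    then show ?thesis using x y by (simp add: set_planes_def)
  qed
  have obs_r: "bounded_obs \<Lambda> ?r"
    by (intro bounded_obs_power bounded_obs_mult bounded_obs_plane_radius x y)
  note Gw = bounded_obs_mult[OF G bounded_obs_NV_weight[of \<Lambda> J']]
    and rw = bounded_obs_mult[OF obs_r bounded_obs_NV_weight[of \<Lambda> J']]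
  have fubini: "integrable ?S' (\<lambda>\<sigma>. \<integral>\<phi>. F (?T \<phi> \<sigma>) \<partial>?A)"
    "(\<integral>\<sigma>. \<integral>\<phi>. F (?T \<phi> \<sigma>) \<partial>?A \<partial>?S') = integral\<^sup>L (sphere_PiM \<Lambda>) F" if F: "bounded_obs \<Lambda> F" for F
  proof -
    have pair: "(\<lambda>(\<phi>, \<sigma>). F (?T \<phi> \<sigma>)) = (\<lambda>p. F (set_planes \<Lambda> i j 0 p))" by auto
    have int: "integrable (?A \<Otimes>\<^sub>M ?S') (\<lambda>(\<phi>, \<sigma>). F (?T \<phi> \<sigma>))"
      unfolding pair by (rule set_planes_transfer(1)[OF \<Lambda> ij F])
    show "integrable ?S' (\<lambda>\<sigma>. \<integral>\<phi>. F (?T \<phi> \<sigma>) \<partial>?A)"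
      by (rule AS.integrable_snd[OF int])
    show "(\<integral>\<sigma>. \<integral>\<phi>. F (?T \<phi> \<sigma>) \<partial>?A \<partial>?S') = integral\<^sup>L (sphere_PiM \<Lambda>) F"
      unfolding AS.integral_snd[OF int] unfolding pair by (rule set_planes_transfer(2)[OF \<Lambda> ij F])
  qed
  let ?g = "\<lambda>\<sigma>. \<integral>\<phi>. G (?T \<phi> \<sigma>) * ?w (?T \<phi> \<sigma>) \<partial>?A"
  let ?h = "\<lambda>\<sigma>. \<integral>\<phi>. ?r (?T \<phi> \<sigma>) * ?w (?T \<phi> \<sigma>) \<partial>?A"
  have g: "?g \<sigma> = ?r \<sigma> * e \<sigma> * (\<integral>\<phi>. cos (real m * (\<phi> x - \<phi> y)) * XY_weight \<Lambda> (K \<sigma>) \<phi> \<partial>?A)" for \<sigma>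
    unfolding w G_eq by (subst integral_mult_right_zero[symmetric]) (simp add: mult_ac)
  have h: "?h \<sigma> = ?r \<sigma> * e \<sigma> * integral\<^sup>L ?A (XY_weight \<Lambda> (K \<sigma>))" for \<sigma>
    unfolding w r by (subst integral_mult_right_zero[symmetric]) (simp add: mult_ac)
  \<comment> \<open>Ginibre's inequality at frozen \<sigma>. The factor
    \<open>XY_corr \<Lambda> J m x y\<close> does not depend on \<sigma>, so it leaves the outer
    integral, while the conditional partition function inside \<open>?h\<close> integrates to the
    N-vector integral of the radii.\<close>
  have gh: "\<bar>?g \<sigma>\<bar> \<le> XY_corr \<Lambda> J m x y * ?h \<sigma>" if \<sigma>: "\<sigma> \<in> space ?S'" for \<sigma>
  proof -
    have n: "norm (\<sigma> u) = 1" if "u \<in> \<Lambda>" for u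
      using \<sigma> that by (auto simp: space_PiM space_scale_measure space_sphere_measure)
    have "\<bar>K \<sigma> u v\<bar> \<le> J u v" if uv: "u \<in> \<Lambda>" "v \<in> \<Lambda>" "u \<noteq> v" for u v
    proof -
      have "\<bar>J' u v\<bar> * (plane_radius i j (\<sigma> u) * plane_radius i j (\<sigma> v)) \<le> J u v * (1 * 1)"
        using J[OF uv] plane_radius_le_1[OF ij n[OF uv(1)]] plane_radius_le_1[OF ij n[OF uv(2)]]
        by (intro mult_mono) auto
      then show ?thesis
        using plane_radius_le_1[OF ij n[OF uv(1)]] plane_radius_le_1[OF ij n[OF uv(2)]]
        by (simp add: K_def abs_mult)
    qed
    from XY_ginibre_corr[OF \<Lambda> x y this, where m=m]
    have "?r \<sigma> * e \<sigma> * \<bar>\<integral>\<phi>. cos (real m * (\<phi> x - \<phi> y)) * XY_weight \<Lambda> (K \<sigma>) \<phi> \<partial>?A\<bar>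
      \<le> ?r \<sigma> * e \<sigma> * (XY_corr \<Lambda> J m x y * integral\<^sup>L ?A (XY_weight \<Lambda> (K \<sigma>)))"
      using plane_radius_le_1[OF ij n[OF x]] plane_radius_le_1[OF ij n[OF y]]
      by (intro mult_left_mono) (auto simp: e_def)
    moreover have "0 \<le> ?r \<sigma> * e \<sigma>"
      using plane_radius_le_1[OF ij n[OF x]] plane_radius_le_1[OF ij n[OF y]] by (simp add: e_def)
    ultimately show ?thesis unfolding g h abs_mult[of "?r \<sigma> * e \<sigma>"] by (simp add: mult_ac)
  qed
  have "\<bar>NV_integral \<Lambda> J' G\<bar> = \<bar>integral\<^sup>L ?S' ?g\<bar>"
    unfolding NV_integral_def fubini(2)[OF Gw] ..
  also have "\<dots> \<le> (\<integral>\<sigma>. \<bar>?g \<sigma>\<bar> \<partial>?S')" by (rule integral_abs_bound)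
  also have "\<dots> \<le> (\<integral>\<sigma>. XY_corr \<Lambda> J m x y * ?h \<sigma> \<partial>?S')"
    using gh fubini(1)[OF Gw] fubini(1)[OF rw] by (intro integral_mono integrable_abs integrable_mult_right) auto
  also have "\<dots> = XY_corr \<Lambda> J m x y * NV_integral \<Lambda> J' ?r"
    unfolding NV_integral_def fubini(2)[OF rw, symmetric] by simp
  finally show ?thesis .
qed

lemma set_planes_nth:
  assumes "i \<noteq> j" "u \<in> \<Lambda>"
  shows "set_planes \<Lambda> i j s (\<phi>, \<sigma>) u $ i = plane_radius i j (\<sigma> u) * cos (\<phi> u + s)"
    and "set_planes \<Lambda> i j s (\<phi>, \<sigma>) u $ j = plane_radius i j (\<sigma> u) * sin (\<phi> u + s)"
  using assms by (simp_all add: set_planes_def plane_set_def)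

text \<open>Rotating every spin by \<open>\<pi>/4\<close> in the plane \<open>(i, j)\<close> turns \<open>cos 2\<theta>\<^sub>x cos 2\<theta>\<^sub>y\<close> into \<open>sin 2\<theta>\<^sub>x sin 2\<theta>\<^sub>y\<close>.\<close>
lemma NV_integral_eighth_turn:
  fixes i j :: "'n::finite"
  assumes \<Lambda>: "finite \<Lambda>" and x: "x \<in> \<Lambda>" and y: "y \<in> \<Lambda>" and ij: "i \<noteq> j"
  shows "NV_integral \<Lambda> K (\<lambda>\<sigma>. ((\<sigma> x $ i)\<^sup>2 - (\<sigma> x $ j)\<^sup>2) * ((\<sigma> y $ i)\<^sup>2 - (\<sigma> y $ j)\<^sup>2))
       = NV_integral \<Lambda> K (\<lambda>\<sigma> :: 'a \<Rightarrow> real ^ 'n. 4 * ((\<sigma> x $ i * \<sigma> x $ j) * (\<sigma> y $ i * \<sigma> y $ j)))"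
proof -
  let ?c = "\<lambda>\<sigma> :: 'a \<Rightarrow> real ^ 'n. ((\<sigma> x $ i)\<^sup>2 - (\<sigma> x $ j)\<^sup>2) * ((\<sigma> y $ i)\<^sup>2 - (\<sigma> y $ j)\<^sup>2)"
  let ?s = "\<lambda>\<sigma> :: 'a \<Rightarrow> real ^ 'n. 4 * ((\<sigma> x $ i * \<sigma> x $ j) * (\<sigma> y $ i * \<sigma> y $ j))"
  let ?w = "NV_weight \<Lambda> K :: ('a \<Rightarrow> real ^ 'n) \<Rightarrow> real"
  have c: "bounded_obs \<Lambda> (\<lambda>\<sigma>. ?c \<sigma> * ?w \<sigma>)" and s: "bounded_obs \<Lambda> (\<lambda>\<sigma>. ?s \<sigma> * ?w \<sigma>)"
    by (intro bounded_obs_mult bounded_obs_diff bounded_obs_power bounded_obs_component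
        bounded_obs_const bounded_obs_NV_weight x y)+
  have eq: "?c (set_planes \<Lambda> i j (pi / 4) p) * ?w (set_planes \<Lambda> i j (pi / 4) p)
      = ?s (set_planes \<Lambda> i j 0 p) * ?w (set_planes \<Lambda> i j 0 p)" for p
  proof (cases p)
    case (Pair \<phi> \<sigma>)
    \<comment> \<open>The identity behind it is cos(2a + \<pi>/2) = - sin 2a. The two minus signs,
      one from each site, cancel, and the two factors 2 give the 4 in \<open>?s\<close>.\<close>
    have "(r * cos (a + pi / 4))\<^sup>2 - (r * sin (a + pi / 4))\<^sup>2 = - (2 * (r * cos a * (r * sin a)))" for r a :: real
    proof -
      have "(r * cos (a + pi / 4))\<^sup>2 - (r * sin (a + pi / 4))\<^sup>2 = r\<^sup>2 * cos (2 * (a + pi / 4))"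
        unfolding cos_double power_mult_distrib by (simp add: right_diff_distrib)
      also have "2 * (a + pi / 4) = 2 * a + pi / 2" by simp
      also have "cos (2 * a + pi / 2) = - (2 * sin a * cos a)" unfolding cos_add sin_double by simp
      finally show ?thesis by (simp add: power2_eq_square mult_ac)
    qed
    then have "?c (set_planes \<Lambda> i j (pi / 4) p) = ?s (set_planes \<Lambda> i j 0 p)"
      unfolding Pair set_planes_nth[OF ij x] set_planes_nth[OF ij y] by simp
    then show ?thesis unfolding Pair NV_weight_set_planes[OF ij] by simp
  qed
  show ?thesis
    unfolding NV_integral_def set_planes_transfer(2)[OF \<Lambda> ij c, of "pi / 4", symmetric]
      set_planes_transfer(2)[OF \<Lambda> ij s, of 0, symmetric] eq ..
qed

section \<open>Summation over coordinate planes\<close>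

text \<open>Every index belongs to 2(N - 1) ordered pairs. Planes are summed over ordered pairs
  throughout, so each is counted twice on both sides.\<close>

lemma sum_off_diagonal:
  fixes f :: "'n::finite \<Rightarrow> real"
  shows "(\<Sum>i\<in>UNIV. \<Sum>j\<in>UNIV - {i}. f i + f j) = 2 * (real CARD('n) - 1) * sum f UNIV"
proof -
  have "(\<Sum>j\<in>UNIV - {i}. f i + f j) = (real CARD('n) - 2) * f i + sum f UNIV" for i
  proof -
    have "(\<Sum>j\<in>UNIV - {i}. f i + f j) = (\<Sum>j\<in>UNIV. f i + f j) - (f i + f i)"
      by (simp add: sum_diff1)
    then show ?thesis by (simp add: sum.distrib algebra_simps)
  qed
  then have "(\<Sum>i\<in>UNIV. \<Sum>j\<in>UNIV - {i}. f i + f j) = (\<Sum>i\<in>UNIV. (real CARD('n) - 2) * f i + sum f UNIV)"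
    by (rule sum.cong[OF refl])
  also have "\<dots> = (real CARD('n) - 2) * sum f UNIV + real CARD('n) * sum f UNIV"
    by (simp add: sum.distrib sum_distrib_left)
  finally show ?thesis by (simp add: algebra_simps)
qed

lemma NV_integral_norm_square:
  assumes \<Lambda>: "finite \<Lambda>" and u: "u \<in> \<Lambda>"
  shows "(\<Sum>k\<in>UNIV. NV_integral \<Lambda> K (\<lambda>\<sigma> :: 'a \<Rightarrow> real ^ 'n. (\<sigma> u $ k)\<^sup>2)) = NV_integral \<Lambda> K (\<lambda>_ :: 'a \<Rightarrow> real ^ 'n. 1)"
proof -
  have "(\<Sum>k\<in>UNIV. (\<sigma> u $ k)\<^sup>2) = 1" if "\<sigma> \<in> space (sphere_PiM \<Lambda>)" for \<sigma> :: "'a \<Rightarrow> real ^ 'n"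
    using norm_sphere_PiM[OF that u] by (simp add: norm_vec_def L2_set_def)
  then have "NV_integral \<Lambda> K (\<lambda>\<sigma> :: 'a \<Rightarrow> real ^ 'n. \<Sum>k\<in>UNIV. (\<sigma> u $ k)\<^sup>2) = NV_integral \<Lambda> K (\<lambda>_ :: 'a \<Rightarrow> real ^ 'n. 1)"
    by (rule NV_integral_cong)
  then show ?thesis
    by (subst (asm) NV_integral_sum[OF \<Lambda>]) (intro bounded_obs_power bounded_obs_component u)
qed

text \<open>Each plane controls \<open>X i + X j\<close> by \<open>B i + B j\<close>. The
  multiplicity 2(N - 1) appears on both sides and cancels, while the total of \<open>B\<close> is 2Z
  since both spins are unit vectors; the 2 is absorbed by the 1/2 of the mean inequality.\<close>

lemma NV_two_point_le:
  assumes \<Lambda>: "finite \<Lambda>" and N: "CARD('n) \<ge> 2" and x: "x \<in> \<Lambda>" and y: "y \<in> \<Lambda>"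
    and J: "\<And>u v. u \<in> \<Lambda> \<Longrightarrow> v \<in> \<Lambda> \<Longrightarrow> u \<noteq> v \<Longrightarrow> \<bar>J' u v\<bar> \<le> J u v"
  shows "\<bar>NV_expect \<Lambda> J' (\<lambda>\<sigma> :: 'a \<Rightarrow> real ^ 'n. \<sigma> x \<bullet> \<sigma> y)\<bar> \<le> XY_corr \<Lambda> J 1 x y"
proof -
  let ?I = "NV_integral \<Lambda> J' :: (('a \<Rightarrow> real ^ 'n) \<Rightarrow> real) \<Rightarrow> real"
  let ?\<gamma> = "XY_corr \<Lambda> J 1 x y"
  note obs = bounded_obs_add bounded_obs_mult bounded_obs_power bounded_obs_component bounded_obs_const
    bounded_obs_plane_radius
  define Z where "Z = ?I (\<lambda>_. 1)"
  define X where "X k = ?I (\<lambda>\<sigma>. \<sigma> x $ k * \<sigma> y $ k)" for k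
  define B where "B k = ?I (\<lambda>\<sigma>. (\<sigma> x $ k)\<^sup>2) + ?I (\<lambda>\<sigma>. (\<sigma> y $ k)\<^sup>2)" for k
  have Z: "0 < Z" unfolding Z_def by (rule NV_integral_one_pos[OF \<Lambda>])
  have \<gamma>: "0 \<le> ?\<gamma>"
  proof (rule XY_corr_nonneg[OF \<Lambda> x y])
    show "0 \<le> J u v" if "u \<in> \<Lambda>" "v \<in> \<Lambda>" "u \<noteq> v" for u v using J[OF that] by linarith
  qed
  have sumX: "sum X UNIV = ?I (\<lambda>\<sigma>. \<sigma> x \<bullet> \<sigma> y)"
    unfolding X_def inner_vec_def inner_real_def by (rule NV_integral_sum[symmetric, OF \<Lambda>]) (intro obs x y)
  have sumB: "sum B UNIV = 2 * Z"
    unfolding B_def sum.distrib NV_integral_norm_square[OF \<Lambda> x] NV_integral_norm_square[OF \<Lambda> y] Z_def by simp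
  have plane: "\<bar>X i + X j\<bar> \<le> ?\<gamma> / 2 * (B i + B j)" if ij: "i \<noteq> j" for i j
  proof -
    have "X i + X j = ?I (\<lambda>\<sigma>. \<sigma> x $ i * \<sigma> y $ i + \<sigma> x $ j * \<sigma> y $ j)"
      unfolding X_def by (rule NV_integral_add[symmetric, OF \<Lambda>]) (intro obs x y)+
    also have "\<bar>\<dots>\<bar> \<le> ?\<gamma> * ?I (\<lambda>\<sigma>. (plane_radius i j (\<sigma> x) * plane_radius i j (\<sigma> y)) ^ 1)"
    proof (rule NV_plane_comparison[OF \<Lambda> x y ij])
      show "\<bar>J' u v\<bar> \<le> J u v" if "u \<in> \<Lambda>" "v \<in> \<Lambda>" "u \<noteq> v" for u v by (rule J[OF that])
      show "set_planes \<Lambda> i j 0 (\<phi>, \<sigma>) x $ i * set_planes \<Lambda> i j 0 (\<phi>, \<sigma>) y $ i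
          + set_planes \<Lambda> i j 0 (\<phi>, \<sigma>) x $ j * set_planes \<Lambda> i j 0 (\<phi>, \<sigma>) y $ j
        = (plane_radius i j (\<sigma> x) * plane_radius i j (\<sigma> y)) ^ 1 * cos (real 1 * (\<phi> x - \<phi> y))"
        for \<phi> and \<sigma> :: "'a \<Rightarrow> real ^ 'n"
        unfolding set_planes_nth[OF ij x] set_planes_nth[OF ij y] by (simp add: cos_diff algebra_simps)
    qed (intro obs x y)
    also have "\<dots> \<le> ?\<gamma> * ((B i + B j) / 2)"
    proof (rule mult_left_mono[OF _ \<gamma>])
      have "?I (\<lambda>\<sigma>. (plane_radius i j (\<sigma> x) * plane_radius i j (\<sigma> y)) ^ 1)
        \<le> ?I (\<lambda>\<sigma>. 1/2 * (((\<sigma> x $ i)\<^sup>2 + (\<sigma> y $ i)\<^sup>2) + ((\<sigma> x $ j)\<^sup>2 + (\<sigma> y $ j)\<^sup>2)))"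
      proof (rule NV_integral_mono[OF \<Lambda>])
        fix \<sigma> :: "'a \<Rightarrow> real ^ 'n"
        let ?r = "plane_radius i j (\<sigma> x)" and ?t = "plane_radius i j (\<sigma> y)"
        have "0 \<le> (?r - ?t)\<^sup>2" by simp
        then have "?r * ?t \<le> 1/2 * (?r\<^sup>2 + ?t\<^sup>2)" by (simp add: power2_diff)
        also have "?r\<^sup>2 + ?t\<^sup>2 = ((\<sigma> x $ i)\<^sup>2 + (\<sigma> y $ i)\<^sup>2) + ((\<sigma> x $ j)\<^sup>2 + (\<sigma> y $ j)\<^sup>2)"
          by (simp add: plane_radius_def)
        finally show "(?r * ?t) ^ 1 \<le> 1/2 * (((\<sigma> x $ i)\<^sup>2 + (\<sigma> y $ i)\<^sup>2) + ((\<sigma> x $ j)\<^sup>2 + (\<sigma> y $ j)\<^sup>2))" by simp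
      qed (intro obs x y)+
      also have "\<dots> = (B i + B j) / 2"
      proof -
        have add: "?I (\<lambda>\<sigma>. f \<sigma> + g \<sigma>) = ?I f + ?I g" if "bounded_obs \<Lambda> f" "bounded_obs \<Lambda> g" for f g
          by (rule NV_integral_add[OF \<Lambda> that])
        show ?thesis
          unfolding NV_integral_cmult B_def by (subst add, (intro obs x y)+)+ simp
      qed
      finally show "?I (\<lambda>\<sigma>. (plane_radius i j (\<sigma> x) * plane_radius i j (\<sigma> y)) ^ 1) \<le> (B i + B j) / 2" .
    qed
    finally show ?thesis by simp
  qed
  have "\<bar>\<Sum>i\<in>UNIV. \<Sum>j\<in>UNIV - {i}. X i + X j\<bar> \<le> (\<Sum>i\<in>UNIV. \<Sum>j\<in>UNIV - {i}. ?\<gamma> / 2 * (B i + B j))"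
    by (intro order_trans[OF sum_abs] sum_mono plane) auto
  also have "\<dots> = ?\<gamma> / 2 * (2 * (real CARD('n) - 1) * (2 * Z))"
    unfolding sum_distrib_left[symmetric] sum_off_diagonal sumB ..
  finally have "2 * (real CARD('n) - 1) * \<bar>sum X UNIV\<bar> \<le> 2 * (real CARD('n) - 1) * (?\<gamma> * Z)"
    unfolding sum_off_diagonal using N by (simp add: abs_mult)
  then have "\<bar>sum X UNIV\<bar> \<le> ?\<gamma> * Z" using N by (subst (asm) mult_le_cancel_left_pos) auto
  then show ?thesis
    unfolding NV_expect_eq sumX[symmetric] Z_def[symmetric] using Z by (simp add: field_simps)
qed

text \<open>The moments enter through three totals: all \<open>Q\<close> sum to Z, all
  \<open>R\<close> sum to V, and their common diagonal sums to P. The rotation by \<pi>/4 gives an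
  equation between them and the plane comparison an inequality between P and Z; P is then
  eliminated.\<close>

lemma NV_square_le:
  assumes \<Lambda>: "finite \<Lambda>" and N: "CARD('n) \<ge> 2" and x: "x \<in> \<Lambda>" and y: "y \<in> \<Lambda>"
    and J: "\<And>u v. u \<in> \<Lambda> \<Longrightarrow> v \<in> \<Lambda> \<Longrightarrow> u \<noteq> v \<Longrightarrow> \<bar>J' u v\<bar> \<le> J u v"
  shows "NV_expect \<Lambda> J' (\<lambda>\<sigma> :: 'a \<Rightarrow> real ^ 'n. (\<sigma> x \<bullet> \<sigma> y)\<^sup>2)
      * (2 * real CARD('n) - (real CARD('n) - 2) * XY_corr \<Lambda> J 2 x y) \<le> 2 + real CARD('n) * XY_corr \<Lambda> J 2 x y"
proof -
  let ?I = "NV_integral \<Lambda> J' :: (('a \<Rightarrow> real ^ 'n) \<Rightarrow> real) \<Rightarrow> real"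
  let ?\<gamma> = "XY_corr \<Lambda> J 2 x y" and ?N = "real CARD('n)"
  note obs = bounded_obs_add bounded_obs_diff bounded_obs_mult bounded_obs_power bounded_obs_component bounded_obs_const
    bounded_obs_plane_radius
  have add: "?I (\<lambda>\<sigma>. f \<sigma> + g \<sigma>) = ?I f + ?I g" if "bounded_obs \<Lambda> f" "bounded_obs \<Lambda> g" for f g
    by (rule NV_integral_add[OF \<Lambda> that])
  have diff: "?I (\<lambda>\<sigma>. f \<sigma> - g \<sigma>) = ?I f - ?I g" if "bounded_obs \<Lambda> f" "bounded_obs \<Lambda> g" for f g
    by (rule NV_integral_diff[OF \<Lambda> that])
  define Z where "Z = ?I (\<lambda>_. 1)"
  define V where "V = ?I (\<lambda>\<sigma>. (\<sigma> x \<bullet> \<sigma> y)\<^sup>2)"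
  define Q where "Q a b = ?I (\<lambda>\<sigma>. (\<sigma> x $ a)\<^sup>2 * (\<sigma> y $ b)\<^sup>2)" for a b
  define R where "R a b = ?I (\<lambda>\<sigma>. (\<sigma> x $ a * \<sigma> x $ b) * (\<sigma> y $ a * \<sigma> y $ b))" for a b
  define P where "P = (\<Sum>a\<in>UNIV. Q a a)"
  have Z: "0 < Z" unfolding Z_def by (rule NV_integral_one_pos[OF \<Lambda>])
  \<comment> \<open>The double sum is the integral of |s_x|^2 |s_y|^2, which is 1 on the
    spheres.\<close>
  have sumQ: "(\<Sum>a\<in>UNIV. \<Sum>b\<in>UNIV. Q a b) = Z"
  proof -
    have "(\<Sum>a\<in>UNIV. \<Sum>b\<in>UNIV. Q a b) = ?I (\<lambda>\<sigma>. \<Sum>a\<in>UNIV. \<Sum>b\<in>UNIV. (\<sigma> x $ a)\<^sup>2 * (\<sigma> y $ b)\<^sup>2)"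
    proof -
      have "bounded_obs \<Lambda> (\<lambda>\<sigma> :: 'a \<Rightarrow> real ^ 'n. \<Sum>b\<in>I. (\<sigma> x $ a)\<^sup>2 * (\<sigma> y $ b)\<^sup>2)" for a I
        by (induction I rule: infinite_finite_induct) (auto intro!: obs x y)
      then show ?thesis
        unfolding Q_def by (subst NV_integral_sum[OF \<Lambda>], assumption, subst NV_integral_sum[OF \<Lambda>]) (intro obs x y refl)+
    qed
    also have "\<dots> = Z"
      unfolding Z_def
    proof (rule NV_integral_cong)
      fix \<sigma> :: "'a \<Rightarrow> real ^ 'n" assume \<sigma>: "\<sigma> \<in> space (sphere_PiM \<Lambda>)"
      have "(\<Sum>k\<in>UNIV. (\<sigma> u $ k)\<^sup>2) = 1" if "u \<in> \<Lambda>" for u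
        using norm_sphere_PiM[OF \<sigma> that] by (simp add: norm_vec_def L2_set_def)
      then show "(\<Sum>a\<in>UNIV. \<Sum>b\<in>UNIV. (\<sigma> x $ a)\<^sup>2 * (\<sigma> y $ b)\<^sup>2) = 1"
        unfolding sum_product[symmetric] using x y by simp
    qed
    finally show ?thesis .
  qed
  have sumR: "(\<Sum>a\<in>UNIV. \<Sum>b\<in>UNIV. R a b) = V"
  proof -
    have "bounded_obs \<Lambda> (\<lambda>\<sigma> :: 'a \<Rightarrow> real ^ 'n. \<Sum>b\<in>I. (\<sigma> x $ a * \<sigma> x $ b) * (\<sigma> y $ a * \<sigma> y $ b))" for a I
      by (induction I rule: infinite_finite_induct) (auto intro!: obs x y)
    then have "(\<Sum>a\<in>UNIV. \<Sum>b\<in>UNIV. R a b)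
        = ?I (\<lambda>\<sigma>. \<Sum>a\<in>UNIV. \<Sum>b\<in>UNIV. (\<sigma> x $ a * \<sigma> x $ b) * (\<sigma> y $ a * \<sigma> y $ b))"
      unfolding R_def by (subst NV_integral_sum[OF \<Lambda>], assumption, subst NV_integral_sum[OF \<Lambda>]) (intro obs x y refl)+
    also have "\<dots> = V"
      unfolding V_def inner_vec_def inner_real_def power2_eq_square sum_product by (simp add: mult_ac)
    finally show ?thesis .
  qed
  have diag: "R a a = Q a a" for a by (simp add: R_def Q_def power2_eq_square)
  have swap: "(\<Sum>a\<in>UNIV. \<Sum>b\<in>UNIV. Q b a) = Z" using sumQ sum.swap[of "\<lambda>a b. Q a b" UNIV UNIV] by simp
  have c: "?I (\<lambda>\<sigma>. ((\<sigma> x $ a)\<^sup>2 - (\<sigma> x $ b)\<^sup>2) * ((\<sigma> y $ a)\<^sup>2 - (\<sigma> y $ b)\<^sup>2)) = (Q a a + Q b b) - (Q a b + Q b a)" for a b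
  proof -
    have "?I (\<lambda>\<sigma>. ((\<sigma> x $ a)\<^sup>2 - (\<sigma> x $ b)\<^sup>2) * ((\<sigma> y $ a)\<^sup>2 - (\<sigma> y $ b)\<^sup>2))
      = ?I (\<lambda>\<sigma>. ((\<sigma> x $ a)\<^sup>2 * (\<sigma> y $ a)\<^sup>2 + (\<sigma> x $ b)\<^sup>2 * (\<sigma> y $ b)\<^sup>2)
          - ((\<sigma> x $ a)\<^sup>2 * (\<sigma> y $ b)\<^sup>2 + (\<sigma> x $ b)\<^sup>2 * (\<sigma> y $ a)\<^sup>2))"
      by (rule NV_integral_cong) (simp add: algebra_simps)
    also have "\<dots> = (Q a a + Q b b) - (Q a b + Q b a)"
      unfolding Q_def by (subst diff, (intro obs x y)+, (subst add, (intro obs x y)+)+) (rule refl)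
    finally show ?thesis .
  qed
  have turn: "(Q a a + Q b b) - (Q a b + Q b a) = 4 * R a b" if "a \<noteq> b" for a b
    using NV_integral_eighth_turn[OF \<Lambda> x y that, of J'] unfolding c NV_integral_cmult R_def .
  \<comment> \<open>In polar form r^2 cos 2\<theta> and r^2 sin 2\<theta> are the difference of
    squares and twice the product of the two components, so \<open>?G\<close> is the observable with
    m = 2. By \<open>turn\<close> its two summands have equal integrals, hence the factor 2 on the
    left.\<close>
  have plane: "2 * ((Q a a + Q b b) - (Q a b + Q b a)) \<le> ?\<gamma> * ((Q a a + Q b b) + (Q a b + Q b a))" if ab: "a \<noteq> b" for a b
  proof -
    let ?G = "\<lambda>\<sigma> :: 'a \<Rightarrow> real ^ 'n. ((\<sigma> x $ a)\<^sup>2 - (\<sigma> x $ b)\<^sup>2) * ((\<sigma> y $ a)\<^sup>2 - (\<sigma> y $ b)\<^sup>2)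
      + 4 * ((\<sigma> x $ a * \<sigma> x $ b) * (\<sigma> y $ a * \<sigma> y $ b))"
    have "2 * ((Q a a + Q b b) - (Q a b + Q b a)) = ((Q a a + Q b b) - (Q a b + Q b a)) + 4 * R a b"
      using turn[OF ab] by simp
    also have "\<dots> = ?I ?G"
      unfolding R_def NV_integral_cmult[symmetric] c[symmetric] by (rule add[symmetric]) (intro obs x y)+
    also have "\<dots> \<le> \<bar>?I ?G\<bar>" by simp
    also have "\<dots> \<le> ?\<gamma> * ?I (\<lambda>\<sigma>. (plane_radius a b (\<sigma> x) * plane_radius a b (\<sigma> y))\<^sup>2)"
    proof (rule NV_plane_comparison[OF \<Lambda> x y ab])
      show "\<bar>J' u v\<bar> \<le> J u v" if "u \<in> \<Lambda>" "v \<in> \<Lambda>" "u \<noteq> v" for u v by (rule J[OF that])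
      fix \<phi> :: "'a \<Rightarrow> real" and \<sigma> :: "'a \<Rightarrow> real ^ 'n"
      have alg: "((r * c)\<^sup>2 - (r * s)\<^sup>2) * ((t * d)\<^sup>2 - (t * e)\<^sup>2) + 4 * ((r * c * (r * s)) * (t * d * (t * e)))
        = (r * t)\<^sup>2 * ((c\<^sup>2 - s\<^sup>2) * (d\<^sup>2 - e\<^sup>2) + (2 * s * c) * (2 * e * d))" for r c s t d e :: real
        by (simp add: power2_eq_square algebra_simps)
      have "real 2 * (\<phi> x - \<phi> y) = 2 * \<phi> x - 2 * \<phi> y" by simp
      then show "?G (set_planes \<Lambda> a b 0 (\<phi>, \<sigma>))
        = (plane_radius a b (\<sigma> x) * plane_radius a b (\<sigma> y))\<^sup>2 * cos (real 2 * (\<phi> x - \<phi> y))"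
        unfolding set_planes_nth[OF ab x] set_planes_nth[OF ab y] alg
        by (simp only: cos_diff cos_double sin_double add_0_right)
    qed (intro obs x y)
    also have "?I (\<lambda>\<sigma>. (plane_radius a b (\<sigma> x) * plane_radius a b (\<sigma> y))\<^sup>2)
      = ?I (\<lambda>\<sigma>. ((\<sigma> x $ a)\<^sup>2 * (\<sigma> y $ a)\<^sup>2 + (\<sigma> x $ b)\<^sup>2 * (\<sigma> y $ b)\<^sup>2)
          + ((\<sigma> x $ a)\<^sup>2 * (\<sigma> y $ b)\<^sup>2 + (\<sigma> x $ b)\<^sup>2 * (\<sigma> y $ a)\<^sup>2))"
      by (rule NV_integral_cong) (simp add: plane_radius_def power_mult_distrib algebra_simps)
    also have "\<dots> = (Q a a + Q b b) + (Q a b + Q b a)"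
      unfolding Q_def by (subst add, (intro obs x y)+)+ (rule refl)
    finally show ?thesis .
  qed
  have off: "(\<Sum>a\<in>UNIV. \<Sum>b\<in>UNIV - {a}. f a b) = (\<Sum>a\<in>UNIV. \<Sum>b\<in>UNIV. f a b) - (\<Sum>a\<in>UNIV. f a a)"
    for f :: "'n \<Rightarrow> 'n \<Rightarrow> real"
    by (simp add: sum_diff1 sum_subtractf)
  have S1: "(\<Sum>a\<in>UNIV. \<Sum>b\<in>UNIV - {a}. Q a a + Q b b) = 2 * (?N - 1) * P"
    unfolding P_def by (rule sum_off_diagonal)
  have S2: "(\<Sum>a\<in>UNIV. \<Sum>b\<in>UNIV - {a}. Q a b + Q b a) = 2 * (Z - P)"
    unfolding sum.distrib off sumQ swap P_def by simp
  have S3: "(\<Sum>a\<in>UNIV. \<Sum>b\<in>UNIV - {a}. R a b) = V - P"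
    unfolding off sumR diag P_def ..
  \<comment> \<open>Summed over ordered pairs, \<open>turn\<close> reads 2(N - 1) P - 2(Z - P) = 4(V
    - P), which rearranges to \<open>iso\<close>.\<close>
  have "(\<Sum>a\<in>UNIV. \<Sum>b\<in>UNIV - {a}. (Q a a + Q b b) - (Q a b + Q b a)) = (\<Sum>a\<in>UNIV. \<Sum>b\<in>UNIV - {a}. 4 * R a b)"
    by (intro sum.cong refl turn) auto
  then have iso: "(?N + 2) * P = Z + 2 * V"
    unfolding sum_subtractf S1 S2 sum_distrib_left[symmetric] S3 by (simp add: algebra_simps)
  have "(\<Sum>a\<in>UNIV. \<Sum>b\<in>UNIV - {a}. 2 * ((Q a a + Q b b) - (Q a b + Q b a)))
      \<le> (\<Sum>a\<in>UNIV. \<Sum>b\<in>UNIV - {a}. ?\<gamma> * ((Q a a + Q b b) + (Q a b + Q b a)))"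
    by (intro sum_mono plane) auto
  then have "2 * (2 * (?N - 1) * P - 2 * (Z - P)) \<le> ?\<gamma> * (2 * (?N - 1) * P + 2 * (Z - P))"
    unfolding sum_distrib_left[symmetric] sum_subtractf sum.distrib[of "\<lambda>b. Q _ _ + Q b b"]
      sum.distrib[of "\<lambda>a. \<Sum>b\<in>UNIV - {a}. Q a a + Q b b"] S1 S2 .
  \<comment> \<open>Multiplying by N + 2 makes P occur only in the combination (N + 2) P, so that
    \<open>iso\<close> can be substituted without division.\<close>
  then have le: "(?N + 2) * (2 * (2 * (?N - 1) * P - 2 * (Z - P))) \<le> (?N + 2) * (?\<gamma> * (2 * (?N - 1) * P + 2 * (Z - P)))"
    by (intro mult_left_mono) auto
  have eq: "(?N + 2) * (2 * (2 * (?N - 1) * P - 2 * (Z - P))) = 4 * ?N * ((?N + 2) * P) - 4 * (?N + 2) * Z"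
    "(?N + 2) * (?\<gamma> * (2 * (?N - 1) * P + 2 * (Z - P))) = ?\<gamma> * ((2 * ?N - 4) * ((?N + 2) * P) + 2 * (?N + 2) * Z)"
    by algebra+
  have "4 * ?N * (Z + 2 * V) - 4 * (?N + 2) * Z \<le> ?\<gamma> * ((2 * ?N - 4) * (Z + 2 * V) + 2 * (?N + 2) * Z)"
    using le unfolding eq iso .
  then have "V * (2 * ?N - (?N - 2) * ?\<gamma>) \<le> (2 + ?N * ?\<gamma>) * Z"
    by (simp add: algebra_simps)
  then show ?thesis
    unfolding NV_expect_eq V_def[symmetric] Z_def[symmetric] using Z by (simp add: field_simps)
qed

theorem theoremC7:
  fixes \<Lambda> :: "'a set" and J J' :: "'a \<Rightarrow> 'a \<Rightarrow> real" and x y :: 'a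
  assumes "finite \<Lambda>"
    and "CARD('n) \<ge> 2"
    and "\<And>u v. u \<in> \<Lambda> \<Longrightarrow> v \<in> \<Lambda> \<Longrightarrow> u \<noteq> v \<Longrightarrow> J u v = J v u"
    and "\<And>u v. u \<in> \<Lambda> \<Longrightarrow> v \<in> \<Lambda> \<Longrightarrow> u \<noteq> v \<Longrightarrow> J' u v = J' v u"
    and "\<And>u v. u \<in> \<Lambda> \<Longrightarrow> v \<in> \<Lambda> \<Longrightarrow> u \<noteq> v \<Longrightarrow> \<bar>J' u v\<bar> \<le> J u v"
    and "x \<in> \<Lambda>" and "y \<in> \<Lambda>"
  shows "\<bar>NV_expect \<Lambda> J' (\<lambda>\<sigma>::'a \<Rightarrow> real ^ 'n. \<sigma> x \<bullet> \<sigma> y)\<bar>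
           \<le> XY_expect \<Lambda> J (\<lambda>\<theta>. cos (\<theta> x - \<theta> y))
         \<and> (let N = real CARD('n);
             \<gamma> = XY_expect \<Lambda> J (\<lambda>\<theta>. cos (2 * (\<theta> x - \<theta> y)));
             E = NV_expect \<Lambda> J' (\<lambda>\<sigma>::'a \<Rightarrow> real ^ 'n. (\<sigma> x \<bullet> \<sigma> y)\<^sup>2)
         in 0 \<le> E
            \<and> E \<le> 1/N + (N - 1) * (N + 2) / (N * (2*N - (N - 2) * \<gamma>)) * \<gamma>
            \<and> 1/N + (N - 1) * (N + 2) / (N * (2*N - (N - 2) * \<gamma>)) * \<gamma> \<le> 1/N + (1 - 1/N) * \<gamma>)"
proof -
  note \<Lambda> = assms(1) and x = assms(6) and y = assms(7) and J = assms(5)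
  define N where "N = real CARD('n)"
  define \<gamma> where "\<gamma> = XY_expect \<Lambda> J (\<lambda>\<theta>. cos (2 * (\<theta> x - \<theta> y)))"
  define E where "E = NV_expect \<Lambda> J' (\<lambda>\<sigma>::'a \<Rightarrow> real ^ 'n. (\<sigma> x \<bullet> \<sigma> y)\<^sup>2)"
  have corr: "XY_corr \<Lambda> J 1 x y = XY_expect \<Lambda> J (\<lambda>\<theta>. cos (\<theta> x - \<theta> y))" "XY_corr \<Lambda> J 2 x y = \<gamma>"
    by (simp_all add: XY_corr_def \<gamma>_def)
  have N: "2 \<le> N" using assms(2) by (simp add: N_def)
  have \<gamma>0: "0 \<le> \<gamma>" unfolding corr(2)[symmetric]
  proof (rule XY_corr_nonneg[OF \<Lambda> x y])
    show "0 \<le> J u v" if "u \<in> \<Lambda>" "v \<in> \<Lambda>" "u \<noteq> v" for u v using J[OF that] by linarith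
  qed
  have \<gamma>1: "\<gamma> \<le> 1" unfolding corr(2)[symmetric] by (rule XY_corr_le_1[OF \<Lambda> x y])
  \<comment> \<open>Since \<gamma> \<le> 1, the denominator satisfies D \<ge> N + 2. This gives the
    positivity needed for dividing and, later, the last inequality.\<close>
  define D where "D = 2 * N - (N - 2) * \<gamma>"
  have "(N - 2) * \<gamma> \<le> (N - 2) * 1" using N \<gamma>1 by (intro mult_left_mono) auto
  then have D: "N + 2 \<le> D" by (simp add: D_def)
  have E0: "0 \<le> E"
    unfolding E_def NV_expect_eq NV_integral_def
    by (intro divide_nonneg_nonneg integral_nonneg_AE) (auto simp: NV_weight_def)
  have "E * D \<le> 2 + N * \<gamma>"
    unfolding E_def D_def N_def corr(2)[symmetric] by (rule NV_square_le[OF \<Lambda> assms(2) x y]) (rule J)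
  then have "E \<le> (2 + N * \<gamma>) / D" using D N by (simp add: field_simps)
  also have "\<dots> = 1/N + (N - 1) * (N + 2) / (N * D) * \<gamma>"
  proof -
    have "(2 + N * \<gamma>) / D = (N * (2 + N * \<gamma>)) / (N * D)" using N by simp
    \<comment> \<open>Splitting off D isolates the infinite-temperature value 1/N; the coefficient
      left on \<gamma> is N^2 + N - 2 = (N - 1)(N + 2).\<close>
    also have "N * (2 + N * \<gamma>) = D + (N - 1) * (N + 2) * \<gamma>" by (simp add: D_def algebra_simps)
    also have "(D + (N - 1) * (N + 2) * \<gamma>) / (N * D) = 1/N + (N - 1) * (N + 2) / (N * D) * \<gamma>"
      using D N by (simp add: add_divide_distrib)
    finally show ?thesis .
  qed
  finally have E1: "E \<le> 1/N + (N - 1) * (N + 2) / (N * D) * \<gamma>" .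
  \<comment> \<open>Replacing N + 2 by the larger D cancels the denominator; \<gamma> \<ge> 0 then
    allows multiplication by \<gamma>.\<close>
  have "(N - 1) * (N + 2) / (N * D) \<le> (N - 1) * D / (N * D)"
    using D N by (intro divide_right_mono mult_left_mono) auto
  also have "\<dots> = 1 - 1/N" using D N by (simp add: field_simps)
  finally have E2: "1/N + (N - 1) * (N + 2) / (N * D) * \<gamma> \<le> 1/N + (1 - 1/N) * \<gamma>"
    using \<gamma>0 by (intro add_left_mono mult_right_mono)
  have "\<bar>NV_expect \<Lambda> J' (\<lambda>\<sigma>::'a \<Rightarrow> real ^ 'n. \<sigma> x \<bullet> \<sigma> y)\<bar> \<le> XY_corr \<Lambda> J 1 x y"
    by (rule NV_two_point_le[OF \<Lambda> assms(2) x y]) (rule J)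
  then show ?thesis
    using E0 E1 E2
    unfolding corr(1) E_def D_def N_def \<gamma>_def Let_def by blast
qed

end
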